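(* Let $G$ be a graph with maximum degree $\Delta$. Then the following hold. (i) If $G$ is triangle-free, then $\omega_2'(G)\le \frac54\Delta^2$. (ii) If $G$ is $C_5$-free, then $\omega_2'(G)\le \Delta^2$. (iii) If $G$ is $C_{2k+1}$-free for an integer $k\ge 3$, and $\Delta\ge 3k^2+10k$, then $\omega_2'(G)\le\Delta^2$.
   Context: Graphs are finite and simple. $C_m$ denotes the cycle with $m$ vertices; a graph is $F$-free if it does not contain $F$ as a (not necessarily induced) subgraph; triangle-free means $C_3$-free. A strong clique of $G$ is a set of edges of $G$ such that any two distinct edges in the set either share an endpoint or are connected by an edge of $G$ (i.e. some edge of $G$ joins an endpoint of one to an endpoint of the other). The strong clique number $\omega_2'(G)$ is the size of a largest strong clique of $G$; equivalently, $\omega_2'(G)=\omega(L(G)^2)$, the clique number of the square of the line graph of $G$. *)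

theory Defs
  imports Complex_Main
begin

record 'a graph =
  verts :: "'a set"
  edges :: "'a set set"

definition simple_graph :: "'a graph \<Rightarrow> bool" where
  "simple_graph G \<longleftrightarrow> finite (verts G) \<and> (\<forall>e\<in>edges G. e \<subseteq> verts G \<and> card e = 2)"

definition degree :: "'a graph \<Rightarrow> 'a \<Rightarrow> nat" where
  "degree G v = card {e \<in> edges G. v \<in> e}"

text \<open>The inserted \<open>0\<close> only matters for the graph without vertices.\<close>

definition max_degree :: "'a graph \<Rightarrow> nat" where
  "max_degree G = Max (insert 0 (degree G ` verts G))"

definition contains_subgraph :: "'a graph \<Rightarrow> 'b graph \<Rightarrow> bool" where
  "contains_subgraph G F \<longleftrightarrow>
     (\<exists>f. inj_on f (verts F) \<and> f ` verts F \<subseteq> verts G \<and> (\<forall>e\<in>edges F. f ` e \<in> edges G))"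

definition free_of :: "'b graph \<Rightarrow> 'a graph \<Rightarrow> bool" where
  "free_of F G \<longleftrightarrow> \<not> contains_subgraph G F"

text \<open>This is the cycle with \<open>m\<close> vertices for \<open>m \<ge> 3\<close>; smaller values are not used.\<close>

definition cycle_graph :: "nat \<Rightarrow> nat graph" where
  "cycle_graph m = \<lparr>verts = {..<m}, edges = {{i, Suc i mod m} | i. i < m}\<rparr>"

definition triangle_free :: "'a graph \<Rightarrow> bool" where
  "triangle_free G \<longleftrightarrow> free_of (cycle_graph 3) G"

definition strong_clique :: "'a graph \<Rightarrow> 'a set set \<Rightarrow> bool" where
  "strong_clique G S \<longleftrightarrow> S \<subseteq> edges G \<and>
     (\<forall>e\<in>S. \<forall>f\<in>S. e \<noteq> f \<longrightarrow> e \<inter> f \<noteq> {} \<or> (\<exists>u\<in>e. \<exists>v\<in>f. {u, v} \<in> edges G))"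

definition strong_clique_number :: "'a graph \<Rightarrow> nat" where
  "strong_clique_number G = Max {card S | S. strong_clique G S}"

end

theory Submission
  imports Defs
begin

text \<open>
  Let \<open>S\<close> be a strong clique, \<open>w\<close> a vertex of maximum \<open>S\<close>-degree \<open>D\<close> and \<open>T\<close> its set of \<open>S\<close>-neighbours.
  A far edge (an edge of \<open>S\<close> without endpoint adjacent to \<open>w\<close>) is linked to every edge \<open>tw\<close> with \<open>t \<in> T\<close>,
  so each vertex of \<open>T\<close> is adjacent to one of its ends. If every far edge has an end adjacent to
  all of \<open>T\<close>, counting gives at most \<open>D (2 \<Delta> - D) \<le> \<Delta>\<^sup>2\<close> edges; otherwise \<open>w\<close>, two vertices of \<open>T\<close>
  and a far edge \<open>xy\<close> form a 5-cycle.

  For \<open>C\<^sub>2\<^sub>k\<^sub>+\<^sub>1\<close>-free graphs with \<open>k \<ge> 3\<close>, every edge of \<open>S\<close> touches a neighbour of \<open>x\<close> or \<open>y\<close>. If many neighbours of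
  \<open>x\<close> had large \<open>S\<close>-degree, they could be strung together into a path which closes up through the
  5-cycle; the two ways around the 5-cycle adjust the parity, and a cycle of length \<open>2 k + 1\<close> arises.
  Hence \<open>S\<close> has only linearly many edges in \<open>\<Delta>\<close>.

  In the triangle-free case the ends of a far edge split \<open>T\<close> into two complementary parts. The
  traces \<open>C x\<close> on \<open>T\<close> of the ends on one side form a chain, and the far edges fall into bipartite classes
  indexed by the members \<open>A\<close> of this chain. The defect of a vertex is the number of edges from it to \<open>T\<close>
  that are missing in \<open>S\<close>; since \<open>card S \<le> D (2 \<Delta> - D) + \<Sum>\<^sub>A gain A\<close>, where the gain of a class is its
  number of edges minus the defects of its vertices, the gains have to be bounded. For \<open>3 D < 2 \<Delta>\<close> cutting
  the chain in the middle gives \<open>\<Delta> D / 2\<close>. For \<open>3 D \<ge> 2 \<Delta>\<close> some class of positive gain has vertices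
  whose defects pay for all smaller classes on one side and for all larger classes on the other, and
  optimising over the sizes of this class gives \<open>\<Delta>\<^sup>2 / 4 + (\<Delta> - D)\<^sup>2\<close>.
\<close>

section \<open>Edges pairwise within distance two\<close>

text \<open>The edge set is a parameter, so that the notion serves for all edges \<open>E\<close>,
  for the clique \<open>S\<close> and for its far edges \<open>F\<close> alike.\<close>

definition nb :: "'a set set \<Rightarrow> 'a \<Rightarrow> 'a set" where
  "nb E v = {u. {u, v} \<in> E}"

lemma mem_nb: "u \<in> nb E v \<longleftrightarrow> {u, v} \<in> E"
  by (simp add: nb_def)

lemma nb_sym: "u \<in> nb E v \<longleftrightarrow> v \<in> nb E u"
  by (simp add: nb_def insert_commute)

lemma nb_mono: "F \<subseteq> E \<Longrightarrow> nb F v \<subseteq> nb E v"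
  by (auto simp: nb_def)

lemma card_filter_swap:
  assumes "finite A" "finite B"
  shows "(\<Sum>x\<in>A. card {y\<in>B. P x y}) = (\<Sum>y\<in>B. card {x\<in>A. P x y})"
proof -
  have "(\<Sum>x\<in>A. card {y\<in>B. P x y}) = (\<Sum>x\<in>A. \<Sum>y\<in>B. if P x y then 1 else 0)"
    using assms by (simp add: sum.If_cases Int_def)
  also have "\<dots> = (\<Sum>y\<in>B. \<Sum>x\<in>A. if P x y then 1 else 0)"
    by (rule sum.swap)
  also have "\<dots> = (\<Sum>y\<in>B. card {x\<in>A. P x y})"
    using assms by (simp add: sum.If_cases Int_def)
  finally show ?thesis .
qed

text \<open>A strong clique seen through edge sets alone. \<open>linked\<close> asks for disjoint
  edges only, since edges with a common end satisfy the clique condition anyway.\<close>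

locale linked_edges =
  fixes E S :: "'a set set" and \<Delta> :: nat
  assumes finite_E: "finite E"
    and card_edge: "e \<in> E \<Longrightarrow> card e = 2"
    and S_sub: "S \<subseteq> E"
    and deg_le: "card (nb E v) \<le> \<Delta>"
    and linked: "e \<in> S \<Longrightarrow> f \<in> S \<Longrightarrow> e \<inter> f = {} \<Longrightarrow> \<exists>u\<in>e. \<exists>v\<in>f. {u, v} \<in> E"
begin

lemma finite_S: "finite S"
  using finite_subset[OF S_sub finite_E] .

lemma edge_cases:
  assumes "e \<in> E"
  obtains x y where "e = {x, y}" "x \<noteq> y" "y \<in> nb E x"
  using card_edge[OF assms] assms by (metis card_2_iff mem_nb nb_sym)

lemma finite_edge: "e \<in> E \<Longrightarrow> finite e"
  using card_edge by (metis card.infinite zero_neq_numeral)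

lemma finite_nb: "F \<subseteq> E \<Longrightarrow> finite (nb F v)"
proof -
  assume "F \<subseteq> E"
  then have "nb F v \<subseteq> \<Union>E" by (auto simp: nb_def)
  moreover have "finite (\<Union>E)" using finite_E finite_edge by auto
  ultimately show ?thesis by (rule finite_subset)
qed

lemmas finite_nbE = finite_nb[OF order_refl] and finite_nbS = finite_nb[OF S_sub]

lemma nb_S_sub: "nb S v \<subseteq> nb E v"
  using nb_mono[OF S_sub] .

lemma nb_irrefl: "v \<notin> nb E v"
  using card_edge[of "{v}"] by (auto simp: nb_def)

text \<open>An edge counted here has an end \<open>z\<close> in \<open>W\<close>, and its other end
  is an \<open>F\<close>-neighbour of \<open>z\<close> outside \<open>B\<close>.\<close>

lemma card_touching_avoiding:
  assumes F: "F \<subseteq> E" and W: "finite W"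
  shows "card {e\<in>F. e \<inter> W \<noteq> {} \<and> e \<inter> B = {}} \<le> (\<Sum>z\<in>W. card (nb F z - B))"
proof -
  have "{e\<in>F. e \<inter> W \<noteq> {} \<and> e \<inter> B = {}} \<subseteq> (\<Union>z\<in>W. (\<lambda>u. {u, z}) ` (nb F z - B))"
  proof
    fix e assume e: "e \<in> {e\<in>F. e \<inter> W \<noteq> {} \<and> e \<inter> B = {}}"
    then obtain z where z: "z \<in> e" "z \<in> W" by auto
    obtain x y where "e = {x, y}" using e F edge_cases by (metis (no_types, lifting) mem_Collect_eq subsetD)
    with z obtain u where "e = {u, z}" by (metis doubleton_eq_iff empty_iff insert_iff)
    then show "e \<in> (\<Union>z\<in>W. (\<lambda>u. {u, z}) ` (nb F z - B))"
      using e z by (auto simp: nb_def)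
  qed
  then have "card {e\<in>F. e \<inter> W \<noteq> {} \<and> e \<inter> B = {}} \<le> card (\<Union>z\<in>W. (\<lambda>u. {u, z}) ` (nb F z - B))"
    using W finite_nb[OF F] by (intro card_mono) auto
  also have "\<dots> \<le> (\<Sum>z\<in>W. card ((\<lambda>u. {u, z}) ` (nb F z - B)))"
    using W by (rule card_UN_le)
  also have "\<dots> \<le> (\<Sum>z\<in>W. card (nb F z - B))"
    using finite_nb[OF F] by (intro sum_mono card_image_le) auto
  finally show ?thesis .
qed

lemma card_touching:
  assumes "F \<subseteq> E" "finite W"
  shows "card {e\<in>F. e \<inter> W \<noteq> {}} \<le> (\<Sum>z\<in>W. card (nb F z))"
  using card_touching_avoiding[OF assms, of "{}"] by simp

text \<open>The edge joining \<open>{x, y}\<close> to \<open>{t, w}\<close> cannot end in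
  \<open>w\<close>, because neither \<open>x\<close> nor \<open>y\<close> is a neighbour of
  \<open>w\<close>; so it ends in \<open>t\<close>.\<close>

lemma far_split:
  assumes "{x, y} \<in> S" "{x, y} \<inter> nb E w = {}" "t \<in> nb S w"
  shows "t \<in> nb E x \<or> t \<in> nb E y"
proof -
  have tw: "{t, w} \<in> S" "t \<in> nb E w" using assms(3) nb_S_sub[of w] by (auto simp: mem_nb[of _ S])
  have xy: "y \<in> nb E x" using assms(1) S_sub by (auto simp: mem_nb insert_commute)
  have "w \<notin> {x, y}" using assms(2) xy by (auto simp: nb_sym)
  then have "{x, y} \<inter> {t, w} = {}" using assms(2) tw(2) by auto
  from linked[OF assms(1) tw(1) this] show ?thesis
    using assms(2) by (auto simp: mem_nb insert_commute)
qed

text \<open>Let \<open>B\<close> be the set of common neighbours of \<open>T\<close>. At most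
  \<open>D * card B\<close> edges of \<open>S\<close> meet \<open>B\<close>, and each vertex of
  \<open>T\<close>, being adjacent to all of \<open>B\<close>, has at most
  \<open>\<Delta> - card B\<close> edges avoiding it; so the size of \<open>B\<close>
  cancels.\<close>

lemma card_S_le_no_split:
  assumes D: "card (nb S w) = D" "\<And>z. card (nb S z) \<le> D"
    and no_split: "\<And>e. e \<in> S \<Longrightarrow> e \<inter> nb E w = {} \<Longrightarrow> \<exists>x\<in>e. nb S w \<subseteq> nb E x"
  shows "card S \<le> \<Delta>\<^sup>2"
proof (cases "nb S w = {}")
  case True
  then have "D = 0" using D(1) by simp
  then have "nb S z = {}" for z using D(2)[of z] finite_nbS by simp
  then have "S = {}" using S_sub edge_cases by (metis (full_types) all_not_in_conv mem_nb subsetD)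
  then show ?thesis by simp
next
  case False
  then obtain t0 where t0: "t0 \<in> nb S w" by auto
  define T where "T = nb S w"
  define B where "B = {x. T \<subseteq> nb E x}"
  have BN: "B \<subseteq> nb E t" if "t \<in> T" for t
    using that by (auto simp: B_def nb_sym)
  have finB: "finite B" using BN[of t0] t0 finite_nbE finite_subset by (auto simp: T_def)
  have B\<Delta>: "card B \<le> \<Delta>"
    using BN[of t0] t0 card_mono[OF finite_nbE, of B t0] deg_le[of t0] by (simp add: T_def)
  have D\<Delta>: "D \<le> \<Delta>"
    using D(1) card_mono[OF finite_nbE nb_S_sub, of w] deg_le[of w] by simp
  let ?e1 = "{e\<in>S. e \<inter> B \<noteq> {}}"
  let ?e2 = "{e\<in>S. e \<inter> T \<noteq> {} \<and> e \<inter> B = {}}"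
  let ?e3 = "{e\<in>S. e \<inter> (nb E w - T) \<noteq> {}}"
  \<comment> \<open>A far edge meets \<open>B\<close> by \<open>no_split\<close>; any other edge
    meets \<open>nb E w\<close>, inside or outside \<open>T\<close>.\<close>
  have "S \<subseteq> ?e1 \<union> ?e2 \<union> ?e3"
    using no_split by (fastforce simp: B_def T_def)
  then have "card S \<le> card (?e1 \<union> ?e2 \<union> ?e3)"
    using finite_S by (intro card_mono) auto
  also have "\<dots> \<le> card ?e1 + card ?e2 + card ?e3"
    by (meson card_Un_le add_le_mono le_trans order_refl)
  also have "\<dots> \<le> D * card B + D * (\<Delta> - card B) + D * (\<Delta> - D)"
  proof (intro add_mono)
    show "card ?e1 \<le> D * card B"
      using card_touching[OF S_sub finB] sum_bounded_above[of B "\<lambda>z. card (nb S z)" D] D(2) by (simp add: mult.commute)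
    have "card (nb S t - B) \<le> \<Delta> - card B" if "t \<in> T" for t
    proof -
      have "card (nb S t - B) \<le> card (nb E t - B)"
        using nb_S_sub finite_nbE by (intro card_mono) auto
      also have "\<dots> = card (nb E t) - card B"
        using BN[OF that] finB by (simp add: card_Diff_subset)
      finally show ?thesis using deg_le[of t] by simp
    qed
    then show "card ?e2 \<le> D * (\<Delta> - card B)"
      using card_touching_avoiding[OF S_sub, of T B] sum_bounded_above[of T "\<lambda>z. card (nb S z - B)" "\<Delta> - card B"]
        D(1) finite_nbS by (simp add: T_def)
    have "card (nb E w - T) \<le> \<Delta> - D"
      using D(1) deg_le[of w] nb_S_sub finite_nbS by (simp add: T_def card_Diff_subset)
    then have "D * card (nb E w - T) \<le> D * (\<Delta> - D)" by (rule mult_le_mono2)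
    moreover have "card ?e3 \<le> D * card (nb E w - T)"
      using card_touching[OF S_sub, of "nb E w - T"] finite_nbE[of w]
        sum_bounded_above[of "nb E w - T" "\<lambda>z. card (nb S z)" D] D(2) by (simp add: mult.commute)
    ultimately show "card ?e3 \<le> D * (\<Delta> - D)" by (rule order_trans[rotated])
  qed
  also have "\<dots> = D * \<Delta> + D * (\<Delta> - D)"
    using B\<Delta> by (simp flip: distrib_left)
  also have "\<dots> \<le> \<Delta>\<^sup>2"
  proof -
    \<comment> \<open>With \<open>d = \<Delta> - D\<close> the two sides differ by
      \<open>d\<^sup>2\<close>.\<close>
    obtain d where "\<Delta> = D + d" using D\<Delta> le_Suc_ex by blast
    then show ?thesis by (simp add: power2_eq_square algebra_simps)
  qed
  finally show ?thesis .
qed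

text \<open>Some far edge has no end adjacent to all of \<open>nb S w\<close>. Choosing
  \<open>p\<close> among the vertices missed by \<open>y\<close> and \<open>q\<close> among those
  missed by \<open>x\<close>, \<open>far_split\<close> joins \<open>p\<close> to \<open>x\<close>
  and \<open>q\<close> to \<open>y\<close>; the 5-cycle is \<open>w p x y q\<close>.\<close>

lemma split_pair:
  assumes D: "card (nb S w) = D" "\<And>z. card (nb S z) \<le> D" and big: "\<not> card S \<le> \<Delta>\<^sup>2"
  obtains x y p q where "{x, y} \<in> S" "{x, y} \<inter> nb E w = {}" "p \<in> nb S w" "q \<in> nb S w"
    "p \<in> nb E x" "q \<in> nb E y" "distinct [w, p, x, y, q]"
proof -
  obtain e where e: "e \<in> S" "e \<inter> nb E w = {}" "\<forall>x\<in>e. \<not> nb S w \<subseteq> nb E x"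
    using card_S_le_no_split[OF D] big by blast
  obtain x y where xy: "e = {x, y}" "x \<noteq> y" "y \<in> nb E x"
    using e(1) S_sub edge_cases by (metis subsetD)
  obtain p q where p: "p \<in> nb S w" "p \<notin> nb E y" and q: "q \<in> nb S w" "q \<notin> nb E x"
    using e(3) xy(1) by blast
  have "p \<in> nb E x" "q \<in> nb E y"
    using far_split[of x y w] e xy(1) p q by auto
  moreover have "p \<in> nb E w" "q \<in> nb E w" using p q nb_S_sub by auto
  moreover have "w \<noteq> x" "w \<noteq> y" using xy e(2) by (auto simp: nb_sym)
  ultimately show ?thesis
    using that[of x y p q] e xy p q nb_irrefl by auto
qed

end

section \<open>A weighted bipartite counting bound\<close>

lemma mult_le_quarter_square: "x * y \<le> ((x + y) / 2)\<^sup>2" for x y :: real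
proof -
  have "((x + y) / 2)\<^sup>2 - x * y = ((x - y) / 2)\<^sup>2" by (simp add: power2_eq_square field_simps)
  then show ?thesis by (smt (verit) zero_le_power2)
qed

text \<open>The left-hand side is linear in \<open>y\<close>, so only the ends of its range matter.\<close>

lemma mixed_rectangle_bound:
  fixes a b d y :: real
  assumes "0 \<le> a" "0 \<le> b" "0 \<le> d" "0 \<le> y" "y \<le> b + d" "b \<le> a + d"
  shows "a * y + (a + d - b) * (b + d - y) \<le> ((a + b + d) / 2)\<^sup>2 + d\<^sup>2"
proof (cases "d \<le> b")
  case True
  have "a * y + (a + d - b) * (b + d - y) = a * (b + d) - (b - d) * (b + d - y)"
    by (simp add: algebra_simps)
  also have "\<dots> \<le> a * (b + d)" using True assms by simp
  also have "\<dots> \<le> ((a + b + d) / 2)\<^sup>2" using mult_le_quarter_square[of a "b + d"] by (simp add: add.assoc)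
  finally show ?thesis by (smt (verit) zero_le_power2)
next
  case False
  have "a * y + (a + d - b) * (b + d - y) = (a + d - b) * (b + d) - (d - b) * y"
    by (simp add: algebra_simps)
  also have "\<dots> \<le> (a + d - b) * (b + d)" using False assms by simp
  also have "\<dots> \<le> ((a + b + d) / 2)\<^sup>2 + d\<^sup>2"
  proof -
    \<comment> \<open>Here \<open>d > b\<close>, so \<open>y = 0\<close> was the worst case; the
      slack is, up to the factor 8, a sum of two squares.\<close>
    have "8 * (((a + b + d) / 2)\<^sup>2 + d\<^sup>2 - (a + d - b) * (b + d)) = (a + b - d)\<^sup>2 + (a - 3 * b - d)\<^sup>2"
      by (simp add: power2_eq_square field_simps)
    then show ?thesis by (smt (verit) zero_le_power2)
  qed
  finally show ?thesis .
qed

text \<open>Abstract form of one class of far edges \<open>R\<close>: vertices of \<open>X\<close>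
  have a trace of size \<open>a\<close>, those of \<open>Y\<close> the complementary trace of size
  \<open>b\<close>, \<open>d\<close> stands for \<open>\<Delta> - D\<close> and \<open>t\<close> for
  the defect. \<open>X'\<close> and \<open>Y'\<close> are the vertices with an \<open>S\<close>-edge
  into \<open>T\<close>; the others have full defect. Any two vertices from \<open>X'\<close> and
  \<open>Y'\<close> are adjacent in the graph, so \<open>capX\<close> and \<open>capY\<close> count
  all of the opposite set.\<close>

locale bipartite_class =
  fixes X Y X' Y' :: "'a set" and R :: "'a \<Rightarrow> 'a \<Rightarrow> bool" and t :: "'a \<Rightarrow> real" and a b d :: real
  assumes fin: "finite X" "finite Y" and sub: "X' \<subseteq> X" "Y' \<subseteq> Y"
    and nonneg: "0 \<le> a" "0 \<le> b" "0 \<le> d" and d_le: "2 * d \<le> a + b"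
    and t_nonneg: "\<And>q. 0 \<le> t q"
    and degX: "\<And>x. x \<in> X \<Longrightarrow> real (card {y\<in>Y. R x y}) \<le> b + d"
    and degXt: "\<And>x. x \<in> X \<Longrightarrow> real (card {y\<in>Y. R x y}) - t x \<le> b"
    and degY: "\<And>y. y \<in> Y \<Longrightarrow> real (card {x\<in>X. R x y}) \<le> a + d"
    and degYt: "\<And>y. y \<in> Y \<Longrightarrow> real (card {x\<in>X. R x y}) - t y \<le> a"
    and tX: "\<And>x. x \<in> X - X' \<Longrightarrow> t x = a" and tY: "\<And>y. y \<in> Y - Y' \<Longrightarrow> t y = b"
    and capX: "\<And>x. x \<in> X' \<Longrightarrow> Y' \<noteq> {} \<Longrightarrow> real (card Y') + real (card {y\<in>Y - Y'. R x y}) \<le> b + d"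
    and capY: "\<And>y. y \<in> Y' \<Longrightarrow> X' \<noteq> {} \<Longrightarrow> real (card X') + real (card {x\<in>X - X'. R x y}) \<le> a + d"
begin

definition edge_count :: real where
  "edge_count = (\<Sum>x\<in>X. real (card {y\<in>Y. R x y}))"

definition excess :: real where
  "excess = edge_count - sum t X - sum t Y"

lemma edge_count_Y: "edge_count = (\<Sum>y\<in>Y. real (card {x\<in>X. R x y}))"
  unfolding edge_count_def using card_filter_swap[OF fin, of R] by (simp flip: of_nat_sum)

lemma edge_count_prod: "edge_count \<le> real (card X) * real (card Y)"
  unfolding edge_count_def using fin
  by (intro sum_bounded_above) (simp add: card_mono)

lemma edge_count_minus_X: "edge_count - sum t X \<le> b * card X"
  unfolding edge_count_def using sum_bounded_above[of X "\<lambda>x. real (card {y\<in>Y. R x y}) - t x" b] degXt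
  by (simp add: sum_subtractf mult.commute)

lemma edge_count_minus_Y: "edge_count - sum t Y \<le> a * card Y"
  unfolding edge_count_Y using sum_bounded_above[of Y "\<lambda>y. real (card {x\<in>X. R x y}) - t y" a] degYt
  by (simp add: sum_subtractf mult.commute)

text \<open>The number \<open>e\<close> of edges into \<open>Y - Y'\<close> is bounded twice: from
  \<open>Y - Y'\<close> by its degrees, and from \<open>X\<close>, where a vertex of
  \<open>X'\<close> has only \<open>b + d - card Y'\<close> edges left. The first bound turns the
  weights of \<open>Y - Y'\<close> into a multiple of \<open>e\<close>, the second leads to
  \<open>mixed_rectangle_bound\<close>.\<close>

lemma bound_both_sides_clique:
  assumes "X' \<noteq> {}" "Y' \<noteq> {}"
  shows "edge_count - sum t Y - a * card (X - X') \<le> ((a + b + d) / 2)\<^sup>2 + d\<^sup>2"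
proof -
  let ?x = "real (card X')" and ?y = "real (card Y')" and ?zx = "real (card (X - X'))" and ?zy = "real (card (Y - Y'))"
  define e where "e = (\<Sum>y\<in>Y - Y'. real (card {x\<in>X. R x y}))"
  have fin': "finite X'" "finite Y'" using fin sub finite_subset by auto
  have y_le: "?y \<le> b + d" using capX assms by fastforce
  have x_le: "?x \<le> a + d" using capY assms by fastforce
  have e_le1: "e \<le> ?zy * (a + d)"
    unfolding e_def using degY by (intro sum_bounded_above) auto
  have "e = (\<Sum>x\<in>X. real (card {y\<in>Y - Y'. R x y}))"
    unfolding e_def using card_filter_swap[of X "Y - Y'" R] fin by (simp flip: of_nat_sum)
  also have "\<dots> = (\<Sum>x\<in>X'. real (card {y\<in>Y - Y'. R x y})) + (\<Sum>x\<in>X - X'. real (card {y\<in>Y - Y'. R x y}))"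
    using fin sub by (simp add: sum.subset_diff)
  also have "\<dots> \<le> ?x * (b + d - ?y) + ?zx * (b + d)"
  proof (intro add_mono sum_bounded_above)
    fix x assume "x \<in> X'"
    then show "real (card {y\<in>Y - Y'. R x y}) \<le> b + d - ?y" using capX assms by fastforce
  next
    fix x assume "x \<in> X - X'"
    then have "real (card {y\<in>Y. R x y}) \<le> b + d" using degX by auto
    moreover have "card {y\<in>Y - Y'. R x y} \<le> card {y\<in>Y. R x y}" using fin by (intro card_mono) auto
    ultimately show "real (card {y\<in>Y - Y'. R x y}) \<le> b + d" by linarith
  qed
  finally have e_le2: "e \<le> ?x * (b + d - ?y) + ?zx * (b + d)" .
  have "(\<Sum>y\<in>Y'. real (card {x\<in>X. R x y}) - t y) \<le> ?y * a"
    using degYt sub by (intro sum_bounded_above) auto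
  moreover have "sum t (Y - Y') = ?zy * b" using tY by simp
  moreover have "edge_count - sum t Y = (\<Sum>y\<in>Y'. real (card {x\<in>X. R x y}) - t y) + e - sum t (Y - Y')"
    unfolding edge_count_Y e_def using fin sub by (simp add: sum.subset_diff[of Y' Y] sum_subtractf)
  ultimately have main: "edge_count - sum t Y - a * ?zx \<le> a * ?y + (e - b * ?zy - a * ?zx)"
    by (simp add: mult.commute)
  show ?thesis
  proof (cases "a + d < b")
    case True
    \<comment> \<open>The at most \<open>a + d\<close> edges at a vertex of \<open>Y - Y'\<close> do
      not outweigh its weight \<open>b\<close>.\<close>
    have "e \<le> b * ?zy" using e_le1 True mult_left_mono[of "a + d" b ?zy] by (simp add: mult.commute)
    moreover have "0 \<le> a * ?zx" using nonneg by simp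
    moreover have "a * ?y \<le> a * (b + d)" using y_le nonneg by (simp add: mult_left_mono)
    moreover have "a * (b + d) \<le> ((a + b + d) / 2)\<^sup>2"
      using mult_le_quarter_square[of a "b + d"] by (simp add: add.assoc)
    ultimately show ?thesis using main by (smt (verit) zero_le_power2)
  next
    case False
    show ?thesis
    proof (cases "a + d = 0")
      case True
      then have "a = 0" "d = 0" "b = 0" using nonneg False by auto
      then show ?thesis using main e_le1 by simp
    next
      case pos: False
      then have pos: "a + d > 0" using nonneg by simp
      \<comment> \<open>\<open>m\<close> is what is left of each edge into \<open>Y - Y'\<close>
        when the weight \<open>b\<close> of a vertex there is spread over \<open>a + d\<close>
        edges.\<close>
      define m where "m = (a + d - b) / (a + d)"
      have m: "0 \<le> m" "m * (a + d) = a + d - b" using False pos by (auto simp: m_def)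
      have "e - b * ?zy \<le> m * e"
      proof -
        have "e / (a + d) \<le> ?zy" using e_le1 pos by (simp add: field_simps)
        then have "b * (e / (a + d)) \<le> b * ?zy" using nonneg by (intro mult_left_mono) auto
        moreover have "m * e = e - b * (e / (a + d))" using pos by (simp add: m_def field_simps)
        ultimately show ?thesis by linarith
      qed
      also have "m * e \<le> m * (?x * (b + d - ?y) + ?zx * (b + d))"
        using e_le2 m(1) by (rule mult_left_mono)
      finally have 1: "e - b * ?zy - a * ?zx \<le> m * ?x * (b + d - ?y) + ?zx * (m * (b + d) - a)"
        by (simp add: algebra_simps)
      \<comment> \<open>By \<open>d_le\<close>, the \<open>b + d\<close> edges at a vertex of
        \<open>X - X'\<close>, each counted with factor \<open>m\<close>, are covered by its weight
        \<open>a\<close>.\<close>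
      have "m * (b + d) \<le> a"
      proof -
        have "4 * (a\<^sup>2 + b\<^sup>2 - a * b) = (a + b)\<^sup>2 + 3 * (a - b)\<^sup>2" by (simp add: power2_eq_square algebra_simps)
        moreover have "(2 * d)\<^sup>2 \<le> (a + b)\<^sup>2" using d_le nonneg by (intro power_mono) auto
        ultimately have "d\<^sup>2 \<le> a\<^sup>2 + b\<^sup>2 - a * b" by (smt (verit) four_x_squared zero_le_power2)
        then have "(a + d - b) * (b + d) \<le> a * (a + d)" by (simp add: power2_eq_square algebra_simps)
        then show ?thesis using pos by (simp add: m_def field_simps)
      qed
      then have "?zx * (m * (b + d) - a) \<le> 0" by (simp add: mult_nonneg_nonpos)
      moreover have "m * ?x * (b + d - ?y) \<le> (a + d - b) * (b + d - ?y)"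
        using mult_left_mono[OF x_le m(1)] m(2) y_le by (intro mult_right_mono) auto
      ultimately have "edge_count - sum t Y - a * ?zx \<le> a * ?y + (a + d - b) * (b + d - ?y)"
        using main 1 by linarith
      also have "\<dots> \<le> ((a + b + d) / 2)\<^sup>2 + d\<^sup>2"
        using mixed_rectangle_bound[of a b d ?y] nonneg y_le False by simp
      finally show ?thesis .
    qed
  qed
qed

lemma quarter: "u * (a + b + d - u) \<le> ((a + b + d) / 2)\<^sup>2 + d\<^sup>2" for u
  using mult_le_quarter_square[of u "a + b + d - u"] zero_le_power2[of d] by (smt (verit))

text \<open>The two sides differ by \<open>(m - u) * (v - m)\<close>.\<close>

lemma product_bound:
  fixes u v w m :: real
  assumes "u \<le> m" "m \<le> v"
  shows "u * v - m * u + m * (w - v) \<le> m * (w - m)"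
proof -
  have "0 \<le> (m - u) * (v - m)" using assms by simp
  then show ?thesis by (simp add: algebra_simps)
qed

text \<open>The parameter \<open>m\<close> interpolates between \<open>bound_both_sides_clique\<close> at \<open>m = 0\<close> and the product
  bounds at \<open>m = min a (card X)\<close>.\<close>

lemma excess_bound:
  fixes m s :: real
  assumes m: "0 \<le> m" "m \<le> a" "\<And>x. x \<in> X \<Longrightarrow> m \<le> t x"
    and slots: "card X + s \<le> a + b + d" "card Y + s \<le> a + b + d" and s: "0 \<le> s" and pos: "0 < excess"
  shows "excess + m * s \<le> ((a + b + d) / 2)\<^sup>2 + d\<^sup>2"
proof -
  define u v where "u = real (card X)" and "v = real (card Y)"
  let ?N = "a + b + d"
  have uv: "0 \<le> u" "0 \<le> v" by (auto simp: u_def v_def)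
  have tXm: "m * u \<le> sum t X"
    using sum_bounded_below[of X m t] m(3) by (simp add: u_def mult.commute)
  have tYn: "0 \<le> sum t Y" using t_nonneg by (simp add: sum_nonneg)
  have prod: "edge_count \<le> u * v" using edge_count_prod by (simp add: u_def v_def)
  have ms: "m * s \<le> m * (?N - v)" "m * s \<le> m * (?N - u)"
    using slots m(1) by (auto simp: u_def v_def intro: mult_left_mono)
  \<comment> \<open>A positive excess forces \<open>u * v > m * u\<close>; this gives the condition
    on \<open>v\<close> in \<open>product_bound\<close>.\<close>
  have vm: "m < v" "0 < u"
  proof -
    have "0 < u * v - m * u" using pos prod tXm tYn by (simp add: excess_def)
    then have *: "0 < u * (v - m)" by (simp add: algebra_simps)
    then show "0 < u" using uv by (cases "u = 0") auto
    then show "m < v" using * by (simp add: zero_less_mult_iff)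
  qed
  \<comment> \<open>If \<open>X'\<close> or \<open>Y'\<close> is empty, all weights on that side are
    known exactly, \<open>a\<close> or \<open>b\<close> each; if neither is and
    \<open>u > m\<close>, \<open>bound_both_sides_clique\<close> comes in.\<close>
  consider "u \<le> m" | "m < u" "X' = {}" | "m < u" "Y' = {}" | "m < u" "X' \<noteq> {}" "Y' \<noteq> {}" by fastforce
  then show ?thesis
  proof cases
    case 1
    have "excess + m * s \<le> u * v - m * u + m * (?N - v)"
      using prod tXm tYn ms by (simp add: excess_def)
    also have "\<dots> \<le> m * (?N - m)" using 1 vm by (intro product_bound) auto
    finally show ?thesis using quarter[of m] by linarith
  next
    case 2
    then have tXa: "sum t X = a * u" using tX by (simp add: u_def)
    have va: "a < v"
    proof -
      have "0 < u * v - a * u" using pos prod tXa tYn by (simp add: excess_def)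
      then have "0 < u * (v - a)" by (simp add: algebra_simps)
      then show ?thesis using vm by (simp add: zero_less_mult_iff)
    qed
    have "m * s \<le> a * s" using m s by (simp add: mult_right_mono)
    also have "\<dots> \<le> a * (?N - v)" using slots nonneg by (intro mult_left_mono) (auto simp: v_def)
    finally have mas: "m * s \<le> a * (?N - v)" .
    have "excess + m * s \<le> a * (?N - a)"
    proof (cases "u \<le> a")
      case True
      have "excess + m * s \<le> u * v - a * u + a * (?N - v)"
        using prod tXa tYn mas by (simp add: excess_def)
      also have "\<dots> \<le> a * (?N - a)" using True va by (intro product_bound) auto
      finally show ?thesis .
    next
      case False
      have "excess + m * s \<le> a * v - a * u + a * (?N - v)"
        using edge_count_minus_Y tXa mas by (simp add: excess_def v_def)
      also have "\<dots> = a * (?N - u)" by (simp add: algebra_simps)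
      also have "\<dots> \<le> a * (?N - a)" using False nonneg by (intro mult_left_mono) auto
      finally show ?thesis .
    qed
    then show ?thesis using quarter[of a] by linarith
  next
    case 3
    then have tYb: "sum t Y = b * v" using tY by (simp add: v_def)
    have minusX: "excess \<le> b * u - b * v" using edge_count_minus_X tYb by (simp add: excess_def u_def)
    show ?thesis
    proof (cases "m \<le> b")
      case True
      have "m * s \<le> b * s" using True s by (simp add: mult_right_mono)
      also have "\<dots> \<le> b * (?N - u)" using slots nonneg by (intro mult_left_mono) (auto simp: u_def)
      finally have mbs: "m * s \<le> b * (?N - u)" .
      have "excess + m * s \<le> b * (?N - b)"
      proof (cases "v \<le> b")
        case True
        have tXn: "0 \<le> sum t X" using t_nonneg by (simp add: sum_nonneg)
        have "0 < u * v - b * v" using pos prod tYb tXn by (simp add: excess_def)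
        then have "0 < v * (u - b)" by (simp add: algebra_simps)
        then have bu: "b < u" using vm m(1) by (simp add: zero_less_mult_iff)
        have "excess + m * s \<le> v * u - b * v + b * (?N - u)"
          using prod tYb tXn mbs by (simp add: excess_def mult.commute)
        also have "\<dots> \<le> b * (?N - b)" using True bu by (intro product_bound) auto
        finally show ?thesis .
      next
        case False
        have "excess + m * s \<le> b * u - b * v + b * (?N - u)" using minusX mbs by simp
        also have "\<dots> = b * (?N - v)" by (simp add: algebra_simps)
        also have "\<dots> \<le> b * (?N - b)" using False nonneg by (intro mult_left_mono) auto
        finally show ?thesis .
      qed
      then show ?thesis using quarter[of b] by linarith
    next
      case False
      \<comment> \<open>The sum of the two inequalities is
        \<open>m * m \<le> (m - b) * u + b * v\<close>.\<close>
      have "(m - b) * m \<le> (m - b) * u" "b * m \<le> b * v"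
        using False 3 vm nonneg by (auto intro!: mult_left_mono)
      then have "b * u - b * v + m * (?N - u) \<le> m * (?N - m)" by (simp add: algebra_simps)
      then show ?thesis using minusX ms(2) quarter[of m] by linarith
    qed
  next
    case 4
    define x z where "x = real (card X')" and "z = real (card (X - X'))"
    have uxz: "u = x + z"
      using fin sub card_Diff_subset[of X' X] card_mono[of X X'] finite_subset[of X' X]
      by (simp add: u_def x_def z_def of_nat_diff)
    have xz: "0 \<le> x" "0 \<le> z" by (auto simp: x_def z_def)
    have "sum t X = sum t X' + sum t (X - X')" using fin sub by (simp add: sum.subset_diff)
    moreover have "m * x \<le> sum t X'"
      using sum_bounded_below[of X' m t] m(3) sub by (simp add: x_def mult.commute subset_iff)
    moreover have "sum t (X - X') = a * z" using tX by (simp add: z_def)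
    ultimately have tXx: "m * x + a * z \<le> sum t X" by simp
    have h: "excess + m * s \<le> edge_count - sum t Y - a * z + m * (?N - v - x)"
      using tXx ms(1) by (simp add: excess_def algebra_simps)
    \<comment> \<open>If \<open>v + x\<close> is at least \<open>?N\<close>, the last term of
      \<open>h\<close> is not positive and the bound for two nonempty sides suffices; otherwise
      \<open>m\<close> is raised to the smaller of \<open>a\<close> and \<open>u\<close>.\<close>
    show ?thesis
    proof (cases "?N \<le> v + x")
      case True
      then have "m * (?N - v - x) \<le> 0" using m by (simp add: mult_nonneg_nonpos)
      then show ?thesis using h bound_both_sides_clique 4 by (simp add: z_def)
    next
      case False
      show ?thesis
      proof (cases "a \<le> u")
        case True
        have "m * (?N - v - x) \<le> a * (?N - v - x)" using False m by (intro mult_right_mono) auto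
        then have "excess + m * s \<le> a * v - a * z + a * (?N - v - x)"
          using h edge_count_minus_Y by (simp add: v_def)
        also have "\<dots> = a * (?N - u)" by (simp add: uxz algebra_simps)
        also have "\<dots> \<le> a * (?N - a)" using True nonneg by (intro mult_left_mono) auto
        finally show ?thesis using quarter[of a] by linarith
      next
        case au: False
        have "m * (?N - v - x) \<le> u * (?N - v - x)" using False 4 by (intro mult_right_mono) auto
        moreover have "u * z \<le> a * z" using au xz by (intro mult_right_mono) auto
        ultimately have "excess + m * s \<le> u * v - u * z + u * (?N - v - x)"
          using h prod tYn by linarith
        also have "\<dots> = u * (?N - u)" by (simp add: uxz algebra_simps)
        finally show ?thesis using quarter[of u] by linarith
      qed
    qed
  qed
qed

lemma swap: "bipartite_class Y X Y' X' (\<lambda>y x. R x y) t b a d"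
  by unfold_locales (use fin sub nonneg d_le t_nonneg degX degXt degY degYt tX tY capX capY in auto)

lemma excess_swap: "bipartite_class.excess Y X (\<lambda>y x. R x y) t = excess"
proof -
  interpret swap: bipartite_class Y X Y' X' "\<lambda>y x. R x y" t b a d by (rule swap)
  show ?thesis unfolding swap.excess_def excess_def swap.edge_count_def edge_count_Y by simp
qed

text \<open>Raising the smaller of the rates \<open>a'\<close> and \<open>b'\<close> to the larger
  one only increases the left-hand side; then \<open>excess_bound\<close> with
  \<open>s = l + r\<close> applies from the side that has the larger rate.\<close>

lemma excess_bound_two_sided:
  fixes a' b' l r :: real
  assumes a': "0 \<le> a'" "a' \<le> a" "\<And>x. x \<in> X \<Longrightarrow> a' \<le> t x"
    and b': "0 \<le> b'" "b' \<le> b" "\<And>y. y \<in> Y \<Longrightarrow> b' \<le> t y"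
    and slots: "card X + (l + r) \<le> a + b + d" "card Y + (l + r) \<le> a + b + d" and lr: "0 \<le> l" "0 \<le> r"
    and pos: "0 < excess"
  shows "excess + a' * l + b' * r \<le> ((a + b + d) / 2)\<^sup>2 + d\<^sup>2"
proof (cases "b' \<le> a'")
  case True
  have "b' * r \<le> a' * r" using True lr by (intro mult_right_mono)
  moreover have "excess + a' * (l + r) \<le> ((a + b + d) / 2)\<^sup>2 + d\<^sup>2"
    using a' slots lr pos by (intro excess_bound) auto
  ultimately show ?thesis by (simp add: algebra_simps)
next
  case False
  interpret swap: bipartite_class Y X Y' X' "\<lambda>y x. R x y" t b a d by (rule swap)
  have "a' * l \<le> b' * l" using False lr by (intro mult_right_mono) auto
  moreover have "swap.excess + b' * (l + r) \<le> ((b + a + d) / 2)\<^sup>2 + d\<^sup>2"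
    using b' slots lr pos excess_swap by (intro swap.excess_bound) auto
  ultimately show ?thesis using excess_swap by (simp add: algebra_simps)
qed

end

section \<open>Odd cycles\<close>

text \<open>The embedding is the index map \<open>(!) xs\<close>; the wrap-around from the last
  index to \<open>0\<close> is the edge \<open>close\<close>.\<close>

lemma contains_cycle_graph:
  assumes G: "simple_graph G" and d: "distinct xs" and len: "length xs \<ge> 2"
    and path: "successively (\<lambda>u v. {u, v} \<in> edges G) xs" and close: "{last xs, hd xs} \<in> edges G"
  shows "contains_subgraph G (cycle_graph (length xs))"
proof -
  let ?m = "length xs"
  have step: "{xs ! i, xs ! (Suc i mod ?m)} \<in> edges G" if "i < ?m" for i
  proof (cases "Suc i < ?m")
    case True
    then show ?thesis using path by (simp add: successively_conv_nth)
  next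
    case False
    then have "Suc i = ?m" using that by simp
    moreover have "xs \<noteq> []" using len by auto
    ultimately have "xs ! i = last xs" "xs ! (Suc i mod ?m) = hd xs"
      by (simp_all add: last_conv_nth hd_conv_nth) (metis diff_Suc_1 One_nat_def)
    then show ?thesis using close by simp
  qed
  have "xs ! i \<in> verts G" if "i < ?m" for i
    using step[OF that] G by (auto simp: simple_graph_def)
  moreover have "inj_on ((!) xs) {..<?m}"
    using d by (auto simp: inj_on_def nth_eq_iff_index_eq)
  ultimately show ?thesis
    unfolding contains_subgraph_def cycle_graph_def using step
    by (intro exI[of _ "(!) xs"]) auto
qed

section \<open>Paths through vertices of high \<open>S\<close>-degree, closed up to odd
  cycles\<close>

context linked_edges
begin

abbreviation adj :: "'a \<Rightarrow> 'a \<Rightarrow> bool" where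
  "adj u v \<equiv> {u, v} \<in> E"

lemma adj_sym: "adj u v \<Longrightarrow> adj v u"
  by (simp add: insert_commute)

lemma alternating_path:
  assumes "finite A" "finite B" "A \<inter> B = {}" "n \<le> card A" "n \<le> card B"
    and "\<And>a b. a \<in> A \<Longrightarrow> b \<in> B \<Longrightarrow> adj a b" and "n > 0"
  shows "\<exists>xs. distinct xs \<and> length xs = 2 * n \<and> set xs \<subseteq> A \<union> B \<and> successively adj xs
           \<and> hd xs \<in> A \<and> last xs \<in> B"
  using assms
proof (induction n arbitrary: A B)
  case (Suc n)
  obtain a b where ab: "a \<in> A" "b \<in> B" using Suc.prems by fastforce
  show ?case
  proof (cases "n = 0")
    case True
    then show ?thesis using ab Suc.prems by (intro exI[of _ "[a, b]"]) auto
  next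
    case False
    have "\<exists>xs. distinct xs \<and> length xs = 2 * n \<and> set xs \<subseteq> (A - {a}) \<union> (B - {b})
        \<and> successively adj xs \<and> hd xs \<in> A - {a} \<and> last xs \<in> B - {b}"
      using Suc.prems ab False by (intro Suc.IH) auto
    then obtain xs where xs: "distinct xs" "length xs = 2 * n" "set xs \<subseteq> (A - {a}) \<union> (B - {b})"
      "successively adj xs" "hd xs \<in> A - {a}" "last xs \<in> B - {b}" by blast
    have "xs \<noteq> []" using xs(2) False by auto
    moreover have "adj b (hd xs)" using Suc.prems(6)[of "hd xs" b] xs(5) ab by (simp add: insert_commute)
    ultimately show ?thesis using xs ab Suc.prems(3,6)
      by (intro exI[of _ "a # b # xs"]) (auto simp: successively_Cons insert_commute)
  qed
qed simp

text \<open>Otherwise an \<open>S\<close>-edge \<open>za\<close> and an \<open>S\<close>-edge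
  \<open>z'b\<close> with \<open>a\<close> and \<open>b\<close> outside \<open>Q\<close> can only be
  linked by the edge \<open>ab\<close>. This gives a complete bipartite graph with at least
  \<open>k - 1\<close> vertices on either side, and an alternating path of
  \<open>2 * (k - 1)\<close> vertices in it closes through \<open>z'\<close>, \<open>x\<close> and
  \<open>z\<close> to a cycle of length \<open>2 * k + 1\<close>.\<close>

lemma high_pair_linked:
  assumes no_cycle: "\<And>xs. distinct xs \<Longrightarrow> length xs = 2 * k + 1 \<Longrightarrow> successively adj xs \<Longrightarrow> \<not> adj (last xs) (hd xs)"
    and k: "k \<ge> 2" and Q: "finite Q" "x \<in> Q" and z: "z \<in> nb E x" "z' \<in> nb E x" "z \<noteq> z'"
    and high: "card Q + k - 1 \<le> card (nb S z)" "card Q + k - 1 \<le> card (nb S z')"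
  shows "adj z z' \<or> (\<exists>c. c \<notin> Q \<and> adj z c \<and> adj c z')"
proof (rule ccontr)
  assume no: "\<not> (adj z z' \<or> (\<exists>c. c \<notin> Q \<and> adj z c \<and> adj c z'))"
  define A where "A = nb S z - Q"
  define B where "B = nb S z' - Q"
  have A: "adj z a" "a \<notin> Q" "{z, a} \<in> S" if "a \<in> A" for a
    using that S_sub by (auto simp: A_def nb_def insert_commute)
  have B: "adj z' b" "b \<notin> Q" "{z', b} \<in> S" if "b \<in> B" for b
    using that S_sub by (auto simp: B_def nb_def insert_commute)
  have AB: "adj a b" "a \<noteq> b" "a \<noteq> z'" "b \<noteq> z" if "a \<in> A" "b \<in> B" for a b
  proof -
    show ne: "a \<noteq> b" "a \<noteq> z'" "b \<noteq> z"
      using no A[OF that(1)] B[OF that(2)] by (auto simp: insert_commute)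
    have "a \<noteq> z" "b \<noteq> z'" using A(1)[OF that(1)] B(1)[OF that(2)] nb_irrefl by (auto simp: nb_def)
    then have "{z, a} \<inter> {z', b} = {}" using ne z(3) by auto
    from linked[OF A(3)[OF that(1)] B(3)[OF that(2)] this] no A[OF that(1)] B[OF that(2)]
    show "adj a b" by (auto simp: insert_commute)
  qed
  have "card (nb S z) - card Q \<le> card A" "card (nb S z') - card Q \<le> card B"
    unfolding A_def B_def using Q(1) by (simp_all add: diff_card_le_card_Diff)
  then have "k - 1 \<le> card A" "k - 1 \<le> card B" using high k by auto
  then obtain xs where xs: "distinct xs" "length xs = 2 * (k - 1)" "set xs \<subseteq> A \<union> B" "successively adj xs"
    "hd xs \<in> A" "last xs \<in> B"
  proof -
    have "finite A" "finite B" "A \<inter> B = {}" "0 < k - 1"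
      using finite_nbS AB(2) k by (auto simp: A_def B_def)
    then show ?thesis
      using alternating_path[of A B "k - 1"] AB(1) \<open>k - 1 \<le> card A\<close> \<open>k - 1 \<le> card B\<close> that by blast
  qed
  have ne: "xs \<noteq> []" using xs(2) k by auto
  have "z \<notin> set xs" "z' \<notin> set xs" "x \<notin> set xs"
  proof -
    have "u \<noteq> z \<and> u \<noteq> z' \<and> u \<noteq> x" if "u \<in> set xs" for u
    proof (cases "u \<in> A")
      case True
      then show ?thesis using A[OF True] AB(3)[OF True xs(6)] Q(2) nb_irrefl[of z] by (auto simp: nb_def)
    next
      case False
      then have "u \<in> B" using xs(3) that by auto
      then show ?thesis using B[OF \<open>u \<in> B\<close>] AB(4)[OF xs(5)] Q(2) nb_irrefl[of z'] by (auto simp: nb_def)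
    qed
    then show "z \<notin> set xs" "z' \<notin> set xs" "x \<notin> set xs" by auto
  qed
  moreover have "x \<noteq> z" "x \<noteq> z'" using z nb_irrefl by auto
  ultimately have "distinct (x # z # xs @ [z'])" using xs(1) z(3) by auto
  moreover have "length (x # z # xs @ [z']) = 2 * k + 1" using xs(2) k by simp
  moreover have "successively adj (x # z # xs @ [z'])"
    using xs ne z A(1)[OF xs(5)] B(1)[OF xs(6)]
    by (auto simp: successively_Cons successively_append_iff nb_def insert_commute)
  ultimately have "\<not> adj (last (x # z # xs @ [z'])) (hd (x # z # xs @ [z']))"
    by (rule no_cycle)
  then show False using z(2) by (simp add: nb_def)
qed

text \<open>A path ending in a fixed vertex is prolonged at its front; every step adds one or two to its length,
  so it cannot miss both of two consecutive lengths.\<close>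

lemma path_of_length:
  assumes link: "\<And>z z' Q'. z \<in> H \<Longrightarrow> z' \<in> H \<Longrightarrow> z \<noteq> z' \<Longrightarrow> finite Q' \<Longrightarrow> Q \<subseteq> Q' \<Longrightarrow> card Q' \<le> card Q + n \<Longrightarrow>
        adj z z' \<or> (\<exists>c. c \<notin> Q' \<and> adj z c \<and> adj c z')"
    and Q: "finite Q" "Q \<inter> H = {}" and H: "finite H" "n \<le> card H" and e: "e \<in> H" and m: "m + 2 \<le> n"
  shows "\<exists>xs. distinct xs \<and> (length xs = m + 1 \<or> length xs = m + 2) \<and> successively adj xs \<and> hd xs \<in> H
           \<and> last xs = e \<and> set xs \<inter> Q = {}"
  using m
proof (induction m)
  case 0
  then show ?case using e Q by (intro exI[of _ "[e]"]) auto
next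
  case (Suc m)
  then obtain xs where xs: "distinct xs" "length xs = m + 1 \<or> length xs = m + 2" "successively adj xs"
    "hd xs \<in> H" "last xs = e" "set xs \<inter> Q = {}" by auto
  show ?case
  proof (cases "length xs = m + 2")
    case True
    then show ?thesis using xs by (intro exI[of _ xs]) auto
  next
    case False
    then have len: "length xs = m + 1" using xs by auto
    then have ne: "xs \<noteq> []" by auto
    have cxs: "card (set xs) = m + 1" using xs(1) len by (simp add: distinct_card)
    then have "\<not> H \<subseteq> set xs" using H Suc.prems card_mono[of "set xs" H] by auto
    then obtain z where z: "z \<in> H" "z \<notin> set xs" by auto
    have hd: "hd xs \<in> set xs" using ne by simp
    have "card (Q \<union> set xs \<union> {z}) \<le> card Q + (m + 1) + 1"
      using card_Un_le[of "Q \<union> set xs" "{z}"] card_Un_le[of Q "set xs"] cxs by simp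
    then have "adj z (hd xs) \<or> (\<exists>c. c \<notin> Q \<union> set xs \<union> {z} \<and> adj z c \<and> adj c (hd xs))"
      using z xs(4) hd Q(1) Suc.prems by (intro link) auto
    then show ?thesis
    proof (elim disjE exE conjE)
      assume "adj z (hd xs)"
      then show ?thesis using xs z ne len Q by (intro exI[of _ "z # xs"]) (auto simp: successively_Cons)
    next
      fix c assume "c \<notin> Q \<union> set xs \<union> {z}" "adj z c" "adj c (hd xs)"
      then show ?thesis using xs z ne len Q by (intro exI[of _ "z # c # xs"]) (auto simp: successively_Cons)
    qed
  qed
qed

text \<open>The cycle starts at \<open>x\<close>, runs along a path \<open>xs\<close> of high
  vertices and connecting vertices to a fixed \<open>e\<close>, from there by \<open>ys\<close> to
  \<open>w\<close> or \<open>q\<close>, and returns along the 5-cycle by \<open>ts\<close>.\<close>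

lemma few_high_neighbours:
  assumes no_cycle: "\<And>xs. distinct xs \<Longrightarrow> length xs = 2 * k + 1 \<Longrightarrow> successively adj xs \<Longrightarrow> \<not> adj (last xs) (hd xs)"
    and k: "k \<ge> 3" and S: "{w, q} \<in> S"
    and C5: "distinct [w, p, x, y, q]" "adj w p" "adj p x" "adj x y" "adj y q" "adj q w"
    and xw: "\<not> adj x w"
  shows "card {z \<in> nb E x. 3 * k + 3 \<le> card (nb S z)} \<le> 2 * k + 3"
proof (rule ccontr)
  define H0 where "H0 = {z \<in> nb E x. 3 * k + 3 \<le> card (nb S z)}"
  assume "\<not> ?thesis"
  then have H0: "2 * k + 4 \<le> card H0" unfolding H0_def by simp
  have finH0: "finite H0" unfolding H0_def using finite_nbE by simp
  define C where "C = {w, p, x, y, q}"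
  have finC: "finite C" and cardC: "card C = 5" using C5(1) by (auto simp: C_def)
  \<comment> \<open>On the 5-cycle only \<open>x\<close> itself and \<open>w\<close> are surely no
    neighbours of \<open>x\<close>; at least \<open>2 * k + 1\<close> high vertices remain off it,
    and \<open>2 * k\<close> once \<open>a\<close> is removed too.\<close>
  have "H0 \<inter> C \<subseteq> {p, y, q}"
    using xw nb_irrefl by (auto simp: H0_def C_def nb_def insert_commute)
  then have "card (H0 \<inter> C) \<le> 3" by (metis card_3_iff card_mono finite.emptyI finite.insertI C5(1) distinct_length_2_or_more)
  then have H0C: "2 * k + 1 \<le> card (H0 - C)"
    using H0 finH0 card_Diff_subset_Int[of H0 C] by (simp add: Int_commute)
  then obtain e where e: "e \<in> H0" "e \<notin> C" by (metis Diff_iff One_nat_def add_is_0 all_not_in_conv card.empty le_zero_eq nat.distinct(1))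
  have "\<not> nb S e \<subseteq> C"
    using e(1) cardC card_mono[OF finC, of "nb S e"] k by (auto simp: H0_def)
  then obtain a where a: "{a, e} \<in> S" "a \<notin> C" by (auto simp: nb_def)
  have ae: "adj e a" "a \<noteq> e" using a(1) S_sub nb_irrefl[of e] by (auto simp: nb_def insert_commute)
  define Q where "Q = insert a C"
  define H where "H = H0 - Q"
  have cardQ: "card Q = 6" "finite Q" using cardC finC a(2) by (auto simp: Q_def)
  have "card (H0 - C) - 1 \<le> card (H0 - C - {a})"
    using diff_card_le_card_Diff[of "{a}" "H0 - C"] by simp
  moreover have "H0 - C - {a} = H" by (auto simp: H_def Q_def)
  ultimately have H: "finite H" "2 * k \<le> card H" "e \<in> H"
    using finH0 H0C e ae by (auto simp: H_def Q_def)
  have HE: "z \<in> nb E x" "3 * k + 3 \<le> card (nb S z)" if "z \<in> H" for z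
    using that by (auto simp: H_def H0_def)
  have path: "\<exists>xs. distinct xs \<and> (length xs = m + 1 \<or> length xs = m + 2) \<and> successively adj xs \<and> hd xs \<in> H
           \<and> last xs = e \<and> set xs \<inter> Q = {}" if "m + 2 \<le> 2 * k - 2" for m
  proof (rule path_of_length[of H Q "2 * k - 2"])
    fix z z' Q' assume *: "z \<in> H" "z' \<in> H" "z \<noteq> z'" "finite Q'" "Q \<subseteq> Q'" "card Q' \<le> card Q + (2 * k - 2)"
    \<comment> \<open>As \<open>card Q' \<le> 6 + (2 * k - 2)\<close>, this sum is the origin of the
      threshold \<open>3 * k + 3\<close>.\<close>
    have "card Q' + k - 1 \<le> 3 * k + 3" using * cardQ k by simp
    then show "adj z z' \<or> (\<exists>c. c \<notin> Q' \<and> adj z c \<and> adj c z')"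
      using * HE[of z] HE[of z'] k by (intro high_pair_linked[OF no_cycle, where x = x]) (auto simp: Q_def C_def)
  qed (use H cardQ that in \<open>auto simp: H_def\<close>)
  have closing: False
    if xs: "distinct xs" "successively adj xs" "hd xs \<in> H" "last xs = e" "set xs \<inter> Q = {}" "xs \<noteq> []"
      and ys: "distinct ys" "set ys \<subseteq> Q - {x}" "ys \<noteq> []" "successively adj ys" "adj e (hd ys)" "adj (last ys) x"
      and len: "length xs + length ys = 2 * k" for xs ys
  proof -
    let ?zs = "x # xs @ ys"
    have "x \<in> Q" by (simp add: Q_def C_def)
    then have "distinct ?zs" using xs ys by auto
    moreover have "successively adj ?zs"
      using xs ys HE[OF xs(3)] by (auto simp: successively_Cons successively_append_iff nb_def insert_commute)
    moreover have "length ?zs = 2 * k + 1" using len by simp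
    ultimately have "\<not> adj (last ?zs) (hd ?zs)" by (intro no_cycle)
    then show False using ys by simp
  qed
  \<comment> \<open>Linking \<open>{a, e}\<close> with \<open>{w, q}\<close> leads from
    \<open>e\<close> to \<open>w\<close> or \<open>q\<close> in one step or, through
    \<open>a\<close>, in two.\<close>
  have "\<exists>ys. distinct ys \<and> set ys \<subseteq> {a, w, q} \<and> ys \<noteq> [] \<and> successively adj ys \<and> adj e (hd ys)
      \<and> (ys = [w] \<or> ys = [q] \<or> ys = [a, w] \<or> ys = [a, q])"
  proof -
    have "{a, e} \<inter> {w, q} = {}" using a e by (auto simp: C_def)
    from linked[OF a(1) S this] consider "adj e w" | "adj e q" | "adj a w" | "adj a q" by auto
    then show ?thesis
    proof cases
      case 1 then show ?thesis by (intro exI[of _ "[w]"]) auto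
    next
      case 2 then show ?thesis by (intro exI[of _ "[q]"]) auto
    next
      case 3 then show ?thesis using ae a(2) by (intro exI[of _ "[a, w]"]) (auto simp: C_def)
    next
      case 4 then show ?thesis using ae a(2) by (intro exI[of _ "[a, q]"]) (auto simp: C_def)
    qed
  qed
  then obtain ys where ys: "distinct ys" "set ys \<subseteq> {a, w, q}" "ys \<noteq> []" "successively adj ys" "adj e (hd ys)"
    "ys = [w] \<or> ys = [q] \<or> ys = [a, w] \<or> ys = [a, q]" by blast
  define j where "j = length ys"
  have j: "j = 1 \<or> j = 2" using ys(6) by (auto simp: j_def)
  obtain xs where xs: "distinct xs" "length xs = 2 * k - 3 - j + 1 \<or> length xs = 2 * k - 3 - j + 2" "successively adj xs"
    "hd xs \<in> H" "last xs = e" "set xs \<inter> Q = {}"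
  proof -
    have "2 * k - 3 - j + 2 \<le> 2 * k - 2" using j k by auto
    from path[OF this] show ?thesis using that by blast
  qed
  have xs_ne: "xs \<noteq> []" using xs(2) by auto
  note adjs = C5(2-6) C5(2-6)[THEN adj_sym]
  \<comment> \<open>From each of \<open>w\<close> and \<open>q\<close> the 5-cycle leads to \<open>x\<close> in two and in three steps.\<close>
  have tails: "\<exists>ts. length ts = i \<and> distinct (ys @ ts) \<and> set (ys @ ts) \<subseteq> Q - {x} \<and> successively adj (ys @ ts)
      \<and> adj (last (ys @ ts)) x" if "i = 1 \<or> i = 2" for i
  proof -
    have sub: "set ys \<subseteq> {a, last ys}" using ys(6) by (elim disjE) simp_all
    have "last ys = w \<or> last ys = q" using ys(6) by auto
    then have "\<exists>ts. length ts = i \<and> successively adj (last ys # ts) \<and> distinct ts \<and> ts \<noteq> [] \<and> set ts \<subseteq> {w, p, y, q} - set ys \<and> adj (last ts) x"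
    proof
      assume w: "last ys = w"
      then have "set ys \<subseteq> {a, w}" using sub by simp
      then show ?thesis using that w adjs C5(1) a(2)
        by (intro exI[of _ "if i = 1 then [p] else [q, y]"]) (auto simp: C_def)
    next
      assume q: "last ys = q"
      then have "set ys \<subseteq> {a, q}" using sub by simp
      then show ?thesis using that q adjs C5(1) a(2)
        by (intro exI[of _ "if i = 1 then [y] else [w, p]"]) (auto simp: C_def)
    qed
    then obtain ts where ts: "length ts = i" "successively adj (last ys # ts)" "distinct ts" "ts \<noteq> []"
      "set ts \<subseteq> {w, p, y, q} - set ys" "adj (last ts) x" by blast
    have "set (ys @ ts) \<subseteq> Q - {x}" using ys(2) ts(5) C5(1) a(2) by (auto simp: Q_def C_def)
    then show ?thesis using ts ys by (intro exI[of _ ts]) (auto simp: successively_Cons successively_append_iff)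
  qed
  \<comment> \<open>The shorter of the two possible lengths of \<open>xs\<close> calls for
    \<open>i = 2\<close>, the longer one for \<open>i = 1\<close>.\<close>
  have "\<exists>i. (i = 1 \<or> i = 2) \<and> length xs + (j + i) = 2 * k"
    using xs(2) j k by (intro exI[of _ "2 * k - length xs - j"]) auto
  then obtain i where i: "i = 1 \<or> i = 2" "length xs + (j + i) = 2 * k" by blast
  obtain ts where ts: "length ts = i" "distinct (ys @ ts)" "set (ys @ ts) \<subseteq> Q - {x}" "successively adj (ys @ ts)"
    "adj (last (ys @ ts)) x" using tails[OF i(1)] by blast
  show False
    by (rule closing[of xs "ys @ ts"]) (use xs xs_ne ts ys i in \<open>auto simp: j_def\<close>)
qed

text \<open>Every edge of \<open>S\<close> is linked to \<open>{x, y}\<close> or meets it, hence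
  touches a neighbour of \<open>x\<close> or \<open>y\<close>. In each of the two neighbourhoods at
  most \<open>2 * k + 3\<close> vertices have \<open>S\<close>-degree up to \<open>\<Delta>\<close>,
  the others less than \<open>3 * k + 3\<close>.\<close>

lemma card_S_le_odd_cycle_free:
  assumes no_cycle: "\<And>xs. distinct xs \<Longrightarrow> length xs = 2 * k + 1 \<Longrightarrow> successively adj xs \<Longrightarrow> \<not> adj (last xs) (hd xs)"
    and k: "k \<ge> 3" and \<Delta>: "10 * k + 12 \<le> \<Delta>"
    and D: "card (nb S w) = D" "\<And>z. card (nb S z) \<le> D"
  shows "card S \<le> \<Delta>\<^sup>2"
proof (rule ccontr)
  assume big: "\<not> card S \<le> \<Delta>\<^sup>2"
  obtain x y p q where split: "{x, y} \<in> S" "{x, y} \<inter> nb E w = {}" "p \<in> nb S w" "q \<in> nb S w"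
    "p \<in> nb E x" "q \<in> nb E y" "distinct [w, p, x, y, q]" using split_pair[OF D big] by blast
  have D\<Delta>: "D \<le> \<Delta>"
    using D(1) card_mono[OF finite_nbE nb_S_sub, of w] deg_le[of w] by simp
  have adjs: "adj w p" "adj p x" "adj x y" "adj y q" "adj q w" "\<not> adj x w" "\<not> adj y w" "{w, q} \<in> S" "{w, p} \<in> S"
    using split S_sub by (auto simp: nb_def insert_commute)
  have sum_nb: "(\<Sum>z\<in>nb E v. card (nb S z)) \<le> \<Delta> * (5 * k + 6)"
    if few: "card {z \<in> nb E v. 3 * k + 3 \<le> card (nb S z)} \<le> 2 * k + 3" for v
  proof -
    let ?H = "{z \<in> nb E v. 3 * k + 3 \<le> card (nb S z)}"
    have "(\<Sum>z\<in>nb E v. card (nb S z)) \<le> (\<Sum>z\<in>nb E v. (if z \<in> ?H then \<Delta> else 0) + (3 * k + 3))"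
      using D(2) D\<Delta> by (intro sum_mono) (auto intro: order_trans trans_le_add1)
    also have "\<dots> = card ?H * \<Delta> + card (nb E v) * (3 * k + 3)"
      using finite_nbE by (simp add: sum.distrib sum.If_cases Int_def)
    also have "\<dots> \<le> (2 * k + 3) * \<Delta> + \<Delta> * (3 * k + 3)"
      using few deg_le[of v] by (intro add_mono mult_le_mono) auto
    finally show ?thesis by (simp add: algebra_simps)
  qed
  have "S \<subseteq> {e\<in>S. e \<inter> nb E x \<noteq> {}} \<union> {e\<in>S. e \<inter> nb E y \<noteq> {}}"
  proof
    fix e assume e: "e \<in> S"
    show "e \<in> {e\<in>S. e \<inter> nb E x \<noteq> {}} \<union> {e\<in>S. e \<inter> nb E y \<noteq> {}}"
    proof (cases "e \<inter> {x, y} = {}")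
      case True
      from linked[OF e split(1) this] show ?thesis using e by (auto simp: nb_def)
    next
      case False
      then show ?thesis using e adjs(3) by (auto simp: nb_def insert_commute)
    qed
  qed
  then have "card S \<le> card ({e\<in>S. e \<inter> nb E x \<noteq> {}} \<union> {e\<in>S. e \<inter> nb E y \<noteq> {}})"
    using finite_S by (intro card_mono) auto
  also have "\<dots> \<le> card {e\<in>S. e \<inter> nb E x \<noteq> {}} + card {e\<in>S. e \<inter> nb E y \<noteq> {}}" by (rule card_Un_le)
  also have "\<dots> \<le> (\<Sum>z\<in>nb E x. card (nb S z)) + (\<Sum>z\<in>nb E y. card (nb S z))"
    by (intro add_mono card_touching S_sub finite_nbE)
  also have "\<dots> \<le> \<Delta> * (5 * k + 6) + \<Delta> * (5 * k + 6)"
  proof (intro add_mono sum_nb)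
    show "card {z \<in> nb E x. 3 * k + 3 \<le> card (nb S z)} \<le> 2 * k + 3"
      using split(7) adjs by (intro few_high_neighbours[OF no_cycle k, where w = w and p = p and y = y and q = q]) auto
    \<comment> \<open>The same lemma for the 5-cycle read backwards,
      \<open>w q y x p\<close>.\<close>
    show "card {z \<in> nb E y. 3 * k + 3 \<le> card (nb S z)} \<le> 2 * k + 3"
      using split(7) adjs by (intro few_high_neighbours[OF no_cycle k, where w = w and p = q and y = x and q = p])
        (auto simp: insert_commute)
  qed
  also have "\<dots> = \<Delta> * (10 * k + 12)" by (simp add: algebra_simps)
  also have "\<dots> \<le> \<Delta>\<^sup>2" using \<Delta> by (simp add: power2_eq_square)
  finally show False using big by simp
qed

end

section \<open>Triangle-free graphs\<close>

locale triangle_free_linked = linked_edges +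
  fixes w :: 'a
  assumes tri: "x \<in> nb E y \<Longrightarrow> z \<in> nb E y \<Longrightarrow> x \<notin> nb E z"
    and max_deg: "card (nb S z) \<le> card (nb S w)"
begin

definition T :: "'a set" where "T = nb S w"

definition D :: nat where "D = card T"

definition F :: "'a set set" where "F = {e \<in> S. e \<inter> nb E w = {}}"

definition C :: "'a \<Rightarrow> 'a set" where "C q = nb E q \<inter> T"

definition defect :: "'a \<Rightarrow> nat" where "defect q = card ((nb E q - nb S q) \<inter> T)"

lemma finT: "finite T"
  unfolding T_def by (rule finite_nbS)

lemma T_sub: "T \<subseteq> nb E w"
  unfolding T_def by (rule nb_S_sub)

lemma T_indep: "p \<in> T \<Longrightarrow> p' \<in> T \<Longrightarrow> p \<notin> nb E p'"
  using tri T_sub by blast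

lemma D_le: "D \<le> \<Delta>"
  unfolding D_def using card_mono[OF finite_nbE T_sub] deg_le[of w] by simp

lemma F_sub: "F \<subseteq> S" "F \<subseteq> E"
  using S_sub by (auto simp: F_def)

lemma finVF: "finite (\<Union>F)"
  using F_sub finite_S finite_edge finite_subset by (metis finite_Union subsetD)

lemma C_sub: "C q \<subseteq> T"
  by (simp add: C_def)

lemma finC: "finite (C q)"
  using C_sub finT finite_subset by blast

lemma VF_notin: "q \<in> \<Union>F \<Longrightarrow> q \<notin> nb E w"
  by (auto simp: F_def)

lemma VF_not_T: "q \<in> \<Union>F \<Longrightarrow> q \<notin> T"
  using VF_notin T_sub by blast

lemma nbF_VF: "z \<in> nb F q \<Longrightarrow> z \<in> \<Union>F \<and> q \<in> \<Union>F"
  by (auto simp: nb_def)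

lemma VF_nbF:
  assumes "q \<in> \<Union>F"
  obtains z where "z \<in> nb F q"
proof -
  obtain e where e: "e \<in> F" "q \<in> e" using assms by auto
  then obtain x y where "e = {x, y}" using F_sub edge_cases by (metis subsetD)
  then show ?thesis using e that by (auto simp: nb_def insert_commute)
qed

lemma adj_disjoint: "q \<in> nb E q' \<Longrightarrow> C q \<inter> C q' = {}"
  using tri[of q q'] by (auto simp: C_def) (metis nb_sym tri)

text \<open>A vertex of \<open>T\<close> in both traces would give a triangle; one in neither would
  contradict \<open>far_split\<close>.\<close>

lemma C_compl: "z \<in> nb F q \<Longrightarrow> C z = T - C q"
proof -
  assume z: "z \<in> nb F q"
  then have F: "{z, q} \<in> F" by (simp add: nb_def)
  have "C z \<inter> C q = {}" using z nb_mono[OF F_sub(2)] by (intro adj_disjoint) auto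
  moreover have "T \<subseteq> C z \<union> C q"
    using far_split[of z q w] F by (auto simp: C_def F_def T_def)
  ultimately show ?thesis using C_sub by blast
qed

lemma card_C: "card (C q) = card (nb S q \<inter> T) + defect q"
proof -
  have "C q = (nb S q \<inter> T) \<union> ((nb E q - nb S q) \<inter> T)" using nb_S_sub by (auto simp: C_def)
  then show ?thesis unfolding defect_def using finT by (simp add: card_Un_disjoint Int_assoc)
       (metis Int_Diff card_Un_disjoint finite_Int Int_commute Diff_disjoint inf_assoc inf_bot_right)
qed

lemma deg_outside_T:
  assumes "Z \<subseteq> nb E q" "Z \<inter> T = {}"
  shows "card Z + card (C q) \<le> \<Delta>"
proof -
  have "card Z + card (C q) = card (Z \<union> C q)"
    using finite_subset[OF assms(1) finite_nbE] finC assms(2) C_sub[of q]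
    by (intro card_Un_disjoint[symmetric]) auto
  also have "\<dots> \<le> card (nb E q)" using assms finite_nbE by (intro card_mono) (auto simp: C_def)
  finally show ?thesis using deg_le[of q] by simp
qed

lemma nbF_not_T: "nb F q \<inter> T = {}"
  using nbF_VF VF_not_T by blast

lemma far_degree: "card (nb F q) + card (C q) \<le> \<Delta>"
  using nb_mono[OF F_sub(2)] nbF_not_T by (intro deg_outside_T) auto

text \<open>All but \<open>defect q\<close> of the edges from \<open>q\<close> to \<open>C q\<close>
  lie in \<open>S\<close>; together with the far edges at \<open>q\<close>, which avoid
  \<open>T\<close>, they are at most \<open>D\<close> edges of \<open>S\<close>.\<close>

lemma far_degree_defect: "card (nb F q) + card (C q) \<le> D + defect q"
proof -
  have "card (nb F q) + card (nb S q \<inter> T) = card (nb F q \<union> (nb S q \<inter> T))"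
    using nbF_not_T finite_nb[OF F_sub(2)] finT by (intro card_Un_disjoint[symmetric]) auto
  also have "\<dots> \<le> card (nb S q)" using nb_mono[OF F_sub(1)] finite_nbS by (intro card_mono) auto
  also have "\<dots> \<le> D" using max_deg by (simp add: D_def T_def)
  finally show ?thesis using card_C[of q] by simp
qed

text \<open>The other edges of \<open>S\<close> meet \<open>nb E w\<close> and are counted by
  \<open>S\<close>-degrees. At a vertex of \<open>T\<close>, each edge outside \<open>S\<close> to a
  far vertex lowers the bound \<open>\<Delta>\<close> by one; in total this is the sum of the
  defects.\<close>

lemma card_S_le_far:
  "card S + (\<Sum>q\<in>\<Union>F. defect q) \<le> D * \<Delta> + D * (\<Delta> - D) + card F"
proof -
  let ?near = "{e\<in>S. e \<inter> nb E w \<noteq> {}}"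
  have "S = ?near \<union> F" by (auto simp: F_def)
  then have "card S \<le> card ?near + card F" by (metis card_Un_le)
  also have "card ?near \<le> (\<Sum>z\<in>nb E w. card (nb S z))" by (intro card_touching S_sub finite_nbE)
  also have "\<dots> = (\<Sum>z\<in>T. card (nb S z)) + (\<Sum>z\<in>nb E w - T. card (nb S z))"
    using sum.subset_diff[OF T_sub finite_nbE] by (simp add: add.commute)
  also have "(\<Sum>z\<in>nb E w - T. card (nb S z)) \<le> card (nb E w - T) * D"
    using sum_bounded_above[of "nb E w - T" "\<lambda>z. card (nb S z)" D] max_deg by (simp add: D_def T_def)
  also have "\<dots> \<le> (\<Delta> - D) * D"
    using deg_le[of w] T_sub finT by (intro mult_le_mono1) (simp add: card_Diff_subset D_def)
  finally have 1: "card S \<le> (\<Sum>z\<in>T. card (nb S z)) + (\<Delta> - D) * D + card F" by simp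
  have "(\<Sum>z\<in>T. card (nb S z)) + (\<Sum>z\<in>T. card {q\<in>\<Union>F. q \<in> nb E z - nb S z}) \<le> D * \<Delta>"
  proof -
    have "card (nb S z) + card {q\<in>\<Union>F. q \<in> nb E z - nb S z} \<le> \<Delta>" for z
    proof -
      have "card (nb S z) + card {q\<in>\<Union>F. q \<in> nb E z - nb S z} = card (nb S z \<union> {q\<in>\<Union>F. q \<in> nb E z - nb S z})"
        using finite_nbS finite_subset[OF _ finVF, of "{q\<in>\<Union>F. q \<in> nb E z - nb S z}"]
        by (intro card_Un_disjoint[symmetric]) auto
      also have "\<dots> \<le> card (nb E z)" using finite_nbE nb_S_sub by (intro card_mono) auto
      finally show ?thesis using deg_le[of z] by simp
    qed
    then have "(\<Sum>z\<in>T. card (nb S z) + card {q\<in>\<Union>F. q \<in> nb E z - nb S z}) \<le> of_nat (card T) * \<Delta>"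
      by (intro sum_bounded_above) auto
    then show ?thesis by (simp add: sum.distrib D_def)
  qed
  moreover have "(\<Sum>z\<in>T. card {q\<in>\<Union>F. q \<in> nb E z - nb S z}) = (\<Sum>q\<in>\<Union>F. defect q)"
  proof -
    have "{z\<in>T. q \<in> nb E z - nb S z} = (nb E q - nb S q) \<inter> T" for q by (auto simp: nb_sym)
    then show ?thesis using card_filter_swap[OF finT finVF, of "\<lambda>z q. q \<in> nb E z - nb S z"]
      by (simp add: defect_def)
  qed
  ultimately show ?thesis using 1 by (simp add: mult.commute)
qed

text \<open>Far edges outside \<open>V\<close> join an empty trace to the full trace
  \<open>T\<close>. They need no class, since the defect of the end with trace \<open>T\<close> pays
  for them.\<close>

definition V where "V = {q\<in>\<Union>F. C q \<noteq> {} \<and> C q \<noteq> T}"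

lemma finV: "finite V"
  unfolding V_def by (rule finite_subset[OF _ finVF]) auto

lemma nbF_V: "z \<in> nb F q \<Longrightarrow> q \<in> V \<Longrightarrow> z \<in> V"
  using C_compl[of z q] nbF_VF[of z q] C_sub[of q] by (auto simp: V_def)

lemma far_link:
  assumes "y \<in> nb F x" "y' \<in> nb F x'" "{x, y} \<inter> {x', y'} = {}"
  shows "x' \<in> nb E x \<or> y' \<in> nb E x \<or> x' \<in> nb E y \<or> y' \<in> nb E y"
proof -
  have "{x, y} \<in> S" "{x', y'} \<in> S" using assms F_sub(1) by (auto simp: nb_def insert_commute)
  from linked[OF this assms(3)] show ?thesis by (auto simp: nb_def insert_commute)
qed

end

section \<open>The traces on one side form a chain\<close>

locale far_chain = triangle_free_linked +
  fixes x0 t0 :: 'a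
  assumes x0: "x0 \<in> V" and x0_min: "q \<in> V \<Longrightarrow> card (C x0) \<le> card (C q)" and t0: "t0 \<in> C x0"
begin

text \<open>Traces of the two ends of a far edge are complementary, so exactly one of them contains
  \<open>t0\<close>; membership of \<open>t0\<close> splits \<open>V\<close> into two sides.\<close>

definition X where "X = {q\<in>V. t0 \<in> C q}"

definition Y where "Y = {q\<in>V. t0 \<notin> C q}"

lemma t0T: "t0 \<in> T"
  using t0 C_sub by blast

lemma finXY: "finite X" "finite Y"
  using finV by (auto simp: X_def Y_def)

lemma X_nbF: "x \<in> X \<Longrightarrow> z \<in> nb F x \<Longrightarrow> z \<in> Y \<and> C z = T - C x"
  using C_compl nbF_V by (auto simp: X_def Y_def)

lemma Y_nbF: "y \<in> Y \<Longrightarrow> z \<in> nb F y \<Longrightarrow> z \<in> X \<and> C z = T - C y"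
  using C_compl nbF_V t0T by (auto simp: X_def Y_def)

lemma V_nbF:
  assumes "q \<in> V"
  obtains z where "z \<in> nb F q"
  using assms VF_nbF by (auto simp: V_def)

lemma X_indep: "x \<in> X \<Longrightarrow> x' \<in> X \<Longrightarrow> x' \<notin> nb E x"
  using adj_disjoint by (fastforce simp: X_def)

lemma X_props: "x \<in> X \<Longrightarrow> C x \<noteq> {} \<and> C x \<subset> T"
  using C_sub[of x] by (auto simp: X_def V_def)

lemma x0X: "x0 \<in> X"
  using x0 t0 by (simp add: X_def)

text \<open>Let \<open>y0\<close> be a far neighbour of \<open>x0\<close>. Of the possible links
  between \<open>{x0, y0}\<close> and \<open>{x, y}\<close>, the pair \<open>x0\<close>,
  \<open>x\<close> is excluded by the common neighbour \<open>t0\<close>; a link from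
  \<open>y0\<close> to \<open>x\<close> or \<open>y\<close> would put that vertex's trace inside the
  smallest trace \<open>C x0\<close>, hence make it equal. Only an edge from \<open>x0\<close> to
  \<open>y\<close> remains.\<close>

lemma X_least:
  assumes x: "x \<in> X" and y: "y \<in> nb F x" and ne: "C x \<noteq> C x0"
  shows "C x0 \<subseteq> C x" "y \<in> nb E x0"
proof -
  obtain y0 where y0: "y0 \<in> nb F x0" using V_nbF x0 by blast
  have Y: "y \<in> Y" "C y = T - C x" "y0 \<in> Y" "C y0 = T - C x0"
    using X_nbF[OF x y] X_nbF[OF x0X y0] by auto
  have small: "C q = C x0" if "C q \<subseteq> C x0" "q \<in> V" for q
    using that x0_min[OF that(2)] finC card_subset_eq[of "C x0" "C q"] card_mono[of "C x0" "C q"] by force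
  have V: "x \<in> V" "y \<in> V" using x Y by (auto simp: X_def Y_def)
  have "{x0, y0} \<inter> {x, y} = {}"
  proof -
    have "y0 \<noteq> y" using Y(2,4) ne C_sub[of x] C_sub[of x0] by (metis double_diff order_refl)
    then show ?thesis using x x0X Y(1,3) ne by (auto simp: X_def Y_def)
  qed
  from far_link[OF y0 y this] have "y \<in> nb E x0"
  proof (elim disjE)
    assume "x \<in> nb E x0" then show ?thesis using X_indep[OF x0X x] by simp
  next
    assume "x \<in> nb E y0"
    then have "C x \<inter> C y0 = {}" by (rule adj_disjoint)
    then have "C x \<subseteq> C x0" using Y C_sub by blast
    then show ?thesis using small[OF _ V(1)] ne by simp
  next
    assume "y \<in> nb E y0"
    then have "C y \<inter> C y0 = {}" by (rule adj_disjoint)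
    then have "C y \<subseteq> C x0" using Y C_sub by blast
    then have "C y = C x0" using small V(2) by simp
    then show ?thesis using t0 Y(1) by (simp add: Y_def)
  qed
  then show "y \<in> nb E x0" "C x0 \<subseteq> C x"
    using adj_disjoint[of y x0] Y C_sub[of x0] by auto
qed

text \<open>For incomparable traces the far edges \<open>xy\<close> and \<open>x'y'\<close> can only
  be linked by \<open>yy'\<close>; but \<open>y\<close> and \<open>y'\<close> are both adjacent to
  \<open>x0\<close> by \<open>X_least\<close>, a triangle.\<close>

lemma chain:
  assumes x: "x \<in> X" "x' \<in> X"
  shows "C x \<subseteq> C x' \<or> C x' \<subseteq> C x"
proof (rule ccontr)
  assume no: "\<not> ?thesis"
  obtain y where y: "y \<in> nb F x" using V_nbF x(1) by (auto simp: X_def)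
  obtain y' where y': "y' \<in> nb F x'" using V_nbF x(2) by (auto simp: X_def)
  have Y: "y \<in> Y" "C y = T - C x" "y' \<in> Y" "C y' = T - C x'"
    using X_nbF[OF x(1) y] X_nbF[OF x(2) y'] by auto
  have ne: "C x \<noteq> C x0" "C x' \<noteq> C x0"
    using no X_least(1)[OF x(1) y] X_least(1)[OF x(2) y'] by auto
  have "{x, y} \<inter> {x', y'} = {}"
  proof -
    have "y \<noteq> y'" using Y(2,4) no C_sub[of x] C_sub[of x'] by (metis double_diff order_refl)
    then show ?thesis using x Y(1,3) no by (auto simp: X_def Y_def)
  qed
  from far_link[OF y y' this] show False
  proof (elim disjE)
    assume "x' \<in> nb E x" then show False using X_indep x by simp
  next
    assume "y' \<in> nb E x"
    then show False using adj_disjoint[of y' x] Y no C_sub[of x] by auto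
  next
    assume "x' \<in> nb E y"
    then show False using adj_disjoint[of x' y] Y no C_sub[of x'] by auto
  next
    assume "y' \<in> nb E y"
    then show False using tri X_least(2)[OF x(1) y ne(1)] X_least(2)[OF x(2) y' ne(2)] by blast
  qed
qed

section \<open>Classes of far edges and their gains\<close>

definition XA where "XA A = {x\<in>X. C x = A}"

definition YA where "YA A = {y\<in>Y. C y = T - A}"

definition gain :: "'a set \<Rightarrow> real" where
  "gain A = (\<Sum>x\<in>XA A. real (card (nb F x))) - (\<Sum>x\<in>XA A. real (defect x)) - (\<Sum>y\<in>YA A. real (defect y))"

lemma finXA: "finite (XA A)" "finite (YA A)"
  using finXY by (auto simp: XA_def YA_def)

lemma nbF_XA:
  assumes "x \<in> XA A"
  shows "{y\<in>YA A. y \<in> nb F x} = nb F x"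
  using assms X_nbF by (auto simp: XA_def YA_def)

lemma nbF_YA:
  assumes "y \<in> YA A" "A \<in> C ` X"
  shows "{x\<in>XA A. y \<in> nb F x} = nb F y"
proof -
  have "A \<subseteq> T" using assms(2) C_sub by auto
  then have "C z = A" "z \<in> X" if "z \<in> nb F y" for z
    using assms(1) Y_nbF[OF _ that] by (auto simp: YA_def)
  then show ?thesis using nb_sym[of y F] by (auto simp: XA_def)
qed

lemma sum_nbF_swap:
  assumes "A \<in> C ` X"
  shows "(\<Sum>x\<in>XA A. real (card (nb F x))) = (\<Sum>y\<in>YA A. real (card (nb F y)))"
proof -
  have "(\<Sum>x\<in>XA A. card {y\<in>YA A. y \<in> nb F x}) = (\<Sum>y\<in>YA A. card {x\<in>XA A. y \<in> nb F x})"
    by (rule card_filter_swap[OF finXA])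
  then have "(\<Sum>x\<in>XA A. card (nb F x)) = (\<Sum>y\<in>YA A. card (nb F y))"
    using nbF_XA nbF_YA[OF _ assms] by simp
  then show ?thesis by (simp flip: of_nat_sum)
qed

lemma sum_over_YA:
  assumes "\<A> \<subseteq> C ` X"
  shows "(\<Sum>A\<in>\<A>. \<Sum>y\<in>YA A. f y) = (\<Sum>y\<in>{y\<in>Y. T - C y \<in> \<A>}. (f y :: real))"
proof -
  have fin: "finite \<A>" using assms finXY finite_subset by blast
  have "(\<Sum>A\<in>\<A>. sum f {y\<in>{y\<in>Y. T - C y \<in> \<A>}. T - C y = A}) = sum f {y\<in>Y. T - C y \<in> \<A>}"
    using fin finXY by (intro sum.group) auto
  moreover have "{y\<in>{y\<in>Y. T - C y \<in> \<A>}. T - C y = A} = YA A" if "A \<in> \<A>" for A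
  proof -
    have "A \<subseteq> T" using that assms C_sub by auto
    then have "C y = T - A \<longleftrightarrow> T - C y = A" for y using C_sub[of y] by blast
    then show ?thesis using that by (auto simp: YA_def)
  qed
  ultimately show ?thesis by (simp cong: sum.cong)
qed

lemma sum_over_XA:
  assumes "\<A> \<subseteq> C ` X"
  shows "(\<Sum>A\<in>\<A>. \<Sum>x\<in>XA A. f x) = (\<Sum>x\<in>{x\<in>X. C x \<in> \<A>}. (f x :: real))"
proof -
  have fin: "finite \<A>" using assms finXY finite_subset by blast
  have "(\<Sum>A\<in>\<A>. sum f {x\<in>{x\<in>X. C x \<in> \<A>}. C x = A}) = sum f {x\<in>X. C x \<in> \<A>}"
    using fin finXY by (intro sum.group) auto
  moreover have "{x\<in>{x\<in>X. C x \<in> \<A>}. C x = A} = XA A" if "A \<in> \<A>" for A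
    using that by (auto simp: XA_def)
  ultimately show ?thesis by (simp cong: sum.cong)
qed

text \<open>A far edge without an end in \<open>X\<close> has an end in \<open>U\<close>, whose
  trace is all of \<open>T\<close>; for such a vertex \<open>far_degree_defect\<close> bounds the
  number of its far edges by its own defect.\<close>

lemma card_F_le_gain:
  "real (card F) - (\<Sum>q\<in>\<Union>F. real (defect q)) \<le> (\<Sum>A\<in>C ` X. gain A)"
proof -
  define U where "U = {q\<in>\<Union>F. C q = T}"
  have finU: "finite U" unfolding U_def by (rule finite_subset[OF _ finVF]) auto
  have "F \<subseteq> {e\<in>F. e \<inter> X \<noteq> {}} \<union> {e\<in>F. e \<inter> U \<noteq> {}}"
  proof
    fix e assume e: "e \<in> F"
    then obtain x y where xy: "e = {x, y}" using F_sub edge_cases by (metis subsetD)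
    then have yx: "y \<in> nb F x" using e by (simp add: nb_def insert_commute)
    note C = C_compl[OF yx]
    show "e \<in> {e\<in>F. e \<inter> X \<noteq> {}} \<union> {e\<in>F. e \<inter> U \<noteq> {}}"
    proof (cases "x \<in> V")
      case True
      then have "y \<in> V" using nbF_V yx by blast
      then show ?thesis using True e xy C t0T by (auto simp: X_def)
    next
      case False
      then have "C x = {} \<or> C x = T" using nbF_VF[OF yx] by (auto simp: V_def)
      then show ?thesis using e xy C nbF_VF[OF yx] by (auto simp: U_def)
    qed
  qed
  then have "card F \<le> card ({e\<in>F. e \<inter> X \<noteq> {}} \<union> {e\<in>F. e \<inter> U \<noteq> {}})"
    using finite_subset[OF F_sub(2) finite_E] by (intro card_mono) auto
  also have "\<dots> \<le> card {e\<in>F. e \<inter> X \<noteq> {}} + card {e\<in>F. e \<inter> U \<noteq> {}}" by (rule card_Un_le)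
  also have "\<dots> \<le> (\<Sum>x\<in>X. card (nb F x)) + (\<Sum>q\<in>U. card (nb F q))"
    using finXY finU by (intro add_mono card_touching F_sub)
  also have "(\<Sum>q\<in>U. card (nb F q)) \<le> (\<Sum>q\<in>U. defect q)"
  proof (rule sum_mono)
    fix q assume "q \<in> U"
    then show "card (nb F q) \<le> defect q" using far_degree_defect[of q] by (simp add: U_def D_def)
  qed
  finally have "real (card F) \<le> (\<Sum>x\<in>X. real (card (nb F x))) + (\<Sum>q\<in>U. real (defect q))"
    by (simp flip: of_nat_sum of_nat_add)
  moreover have "(\<Sum>q\<in>U \<union> (X \<union> Y). real (defect q)) \<le> (\<Sum>q\<in>\<Union>F. real (defect q))"
    using finVF by (intro sum_mono2) (auto simp: U_def X_def Y_def V_def)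
  moreover have "(\<Sum>q\<in>U \<union> (X \<union> Y). real (defect q))
      = (\<Sum>q\<in>U. real (defect q)) + ((\<Sum>q\<in>X. real (defect q)) + (\<Sum>q\<in>Y. real (defect q)))"
    using finU finXY by (subst sum.union_disjoint, auto simp: U_def X_def Y_def V_def)+
  \<comment> \<open>Every \<open>y\<close> in \<open>Y\<close> has a far neighbour in
    \<open>X\<close>, whose trace is \<open>T - C y\<close>.\<close>
  moreover have "{y\<in>Y. T - C y \<in> C ` X} = Y"
    using Y_nbF V_nbF by (auto simp: Y_def) (metis (no_types, lifting) Y_def image_iff mem_Collect_eq)
  moreover have "{x\<in>X. C x \<in> C ` X} = X" by auto
  ultimately show ?thesis
    unfolding gain_def sum_subtractf
    using sum_over_XA[of "C ` X" "\<lambda>x. real (card (nb F x))"] sum_over_XA[of "C ` X" "\<lambda>x. real (defect x)"]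
      sum_over_YA[of "C ` X" "\<lambda>x. real (defect x)"] by simp
qed

lemma gain_le_Y:
  assumes "A \<in> C ` X"
  shows "gain A \<le> (\<Sum>y\<in>YA A. real (card (nb F y)) - real (defect y))"
  unfolding gain_def sum_nbF_swap[OF assms] by (simp add: sum_subtractf sum_nonneg)

lemma gain_le_X: "gain A \<le> (\<Sum>x\<in>XA A. real (card (nb F x)) - real (defect x))"
  unfolding gain_def by (simp add: sum_subtractf sum_nonneg)

lemma net_degree: "real (card (nb F q)) - real (defect q) \<le> real D - real (card (C q))"
  using far_degree_defect[of q] by linarith

lemma card_C_YA: "y \<in> YA A \<Longrightarrow> A \<in> C ` X \<Longrightarrow> real (card (C y)) = real D - real (card A)"
proof -
  assume y: "y \<in> YA A" and "A \<in> C ` X"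
  then have A: "A \<subseteq> T" using C_sub by auto
  then have "card (C y) = D - card A" "card A \<le> D"
    using y finT finite_subset[OF A finT] by (auto simp: YA_def D_def card_Diff_subset card_mono)
  then show ?thesis by simp
qed

text \<open>An \<open>S\<close>-edge from \<open>x\<close> into \<open>A\<close> and one from
  \<open>y\<close> into \<open>T - A'\<close> could not be linked: \<open>x\<close> and
  \<open>y\<close> share the neighbours in \<open>A' - A\<close>, the ends in \<open>T\<close> are
  both adjacent to \<open>w\<close>, and the cross pairs are excluded by the traces. So
  \<open>x\<close> has defect at least \<open>card A\<close> or \<open>y\<close> at least
  \<open>card (T - A')\<close>.\<close>

lemma yield:
  assumes x: "x \<in> XA A'" and y: "y \<in> YA A" and A: "A \<subset> A'"
  shows "nb S x \<inter> A = {} \<or> nb S y \<inter> (T - A') = {}"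
proof (rule ccontr)
  assume "\<not> ?thesis"
  then obtain p p' where p: "p \<in> nb S x" "p \<in> A" and p': "p' \<in> nb S y" "p' \<in> T" "p' \<notin> A'" by blast
  have C: "C x = A'" "C y = T - A" "x \<notin> T" "y \<notin> T"
    using x y VF_not_T by (auto simp: XA_def YA_def X_def Y_def V_def)
  have pT: "p \<in> T" using p A C(1) C_sub[of x] by auto
  have "x \<noteq> y" using x y by (auto simp: XA_def YA_def X_def Y_def)
  then have "{x, p} \<inter> {y, p'} = {}" using C p p' pT A by auto
  moreover have "{x, p} \<in> S" "{y, p'} \<in> S" using p p' by (auto simp: nb_def insert_commute)
  ultimately have "y \<in> nb E x \<or> p' \<in> nb E x \<or> p \<in> nb E y \<or> p' \<in> nb E p"
    using linked[of "{x, p}" "{y, p'}"] by (auto simp: nb_def insert_commute)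
  moreover have "y \<notin> nb E x" using adj_disjoint[of y x] C(1,2) A C_sub[of x] by auto
  moreover have "p' \<notin> nb E x" "p \<notin> nb E y" using C p p' pT by (auto simp: C_def)
  ultimately show False using T_indep pT p' by blast
qed

text \<open>As in \<open>yield\<close>, but with complementary traces, so that an edge between
  \<open>x\<close> and \<open>y\<close> is the one link left.\<close>

lemma class_complete:
  assumes x: "x \<in> XA A" and y: "y \<in> YA A" and "nb S x \<inter> T \<noteq> {}" "nb S y \<inter> T \<noteq> {}"
  shows "y \<in> nb E x"
proof -
  obtain p p' where p: "p \<in> nb S x" "p \<in> T" and p': "p' \<in> nb S y" "p' \<in> T" using assms by blast
  have C: "C x = A" "C y = T - A" "x \<notin> T" "y \<notin> T"
    using x y VF_not_T by (auto simp: XA_def YA_def X_def Y_def V_def)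
  have "p \<in> C x" "p' \<in> C y" using p p' nb_S_sub by (auto simp: C_def)
  then have pA: "p \<in> A" "p' \<notin> A" using C by auto
  have "x \<noteq> y" using x y by (auto simp: XA_def YA_def X_def Y_def)
  then have "{x, p} \<inter> {y, p'} = {}" using C p p' pA by auto
  moreover have "{x, p} \<in> S" "{y, p'} \<in> S" using p p' by (auto simp: nb_def insert_commute)
  ultimately have "y \<in> nb E x \<or> p' \<in> nb E x \<or> p \<in> nb E y \<or> p' \<in> nb E p"
    using linked[of "{x, p}" "{y, p'}"] by (auto simp: nb_def insert_commute)
  moreover have "p' \<notin> nb E x" "p \<notin> nb E y" using C pA p p' by (auto simp: C_def)
  ultimately show ?thesis using T_indep p p' by blast
qed

lemma finite_classes: "\<A> \<subseteq> C ` X \<Longrightarrow> finite \<A>"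
  using finXY finite_subset by blast

lemma class_props: "A \<in> C ` X \<Longrightarrow> A \<noteq> {} \<and> A \<subset> T \<and> finite A"
  using X_props finC by blast

lemma classes_chain: "A \<in> C ` X \<Longrightarrow> B \<in> C ` X \<Longrightarrow> A \<subseteq> B \<or> B \<subseteq> A"
  using chain by blast

text \<open>Some \<open>t\<close> in \<open>T\<close> lies outside every member of \<open>L\<close>
  and inside every member of \<open>R\<close>. It is adjacent to all the vertices counted.\<close>

lemma slots:
  assumes L: "L \<subseteq> C ` X" and R: "R \<subseteq> C ` X" and less: "\<And>A B. A \<in> L \<Longrightarrow> B \<in> R \<Longrightarrow> A \<subset> B"
  shows "card {y\<in>Y. T - C y \<in> L} + card {x\<in>X. C x \<in> R} \<le> \<Delta>"
proof -
  have ch: "subset.chain UNIV L" "subset.chain UNIV R"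
    using classes_chain L R unfolding subset_chain_def by (meson subset_UNIV subsetD)+
  have "\<Union>L = {} \<or> \<Union>L \<in> L"
    using Union_in_chain[OF finite_classes[OF L] _ ch(1)] by auto
  moreover have "R = {} \<or> \<Inter>R \<in> R"
    using Inter_in_chain[OF finite_classes[OF R] _ ch(2)] by auto
  ultimately have "\<Union>L \<subset> T \<inter> \<Inter>R"
  proof (elim disjE)
    assume "\<Union>L = {}" "R = {}"
    then show ?thesis using t0T by auto
  next
    assume *: "\<Union>L = {}" "\<Inter>R \<in> R"
    then have "\<Inter>R \<noteq> {} \<and> \<Inter>R \<subset> T \<and> finite (\<Inter>R)" using R by (intro class_props) (rule subsetD)
    then show ?thesis unfolding *(1) by (auto simp: inf_absorb2 psubset_eq simp del: Inter_iff)
  next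
    assume *: "\<Union>L \<in> L" "R = {}"
    then have "\<Union>L \<noteq> {} \<and> \<Union>L \<subset> T \<and> finite (\<Union>L)" using L by (intro class_props) (rule subsetD)
    then show ?thesis unfolding *(2) by auto
  next
    assume *: "\<Union>L \<in> L" "\<Inter>R \<in> R"
    then have "\<Inter>R \<noteq> {} \<and> \<Inter>R \<subset> T \<and> finite (\<Inter>R)" using R by (intro class_props) (rule subsetD)
    moreover have "\<Union>L \<subset> \<Inter>R" by (rule less[OF *])
    moreover have "T \<inter> \<Inter>R = \<Inter>R" using calculation(1) by (simp add: inf_absorb2 psubset_imp_subset)
    ultimately show ?thesis by simp
  qed
  then obtain t where t: "t \<in> T" "t \<notin> \<Union>L" "t \<in> \<Inter>R" by blast
  have "card {y\<in>Y. T - C y \<in> L} + card {x\<in>X. C x \<in> R} = card ({y\<in>Y. T - C y \<in> L} \<union> {x\<in>X. C x \<in> R})"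
  proof (rule card_Un_disjoint[symmetric])
    show "{y\<in>Y. T - C y \<in> L} \<inter> {x\<in>X. C x \<in> R} = {}" by (auto simp: X_def Y_def)
  qed (use finXY in auto)
  also have "\<dots> \<le> card (nb E t)"
    using t by (intro card_mono finite_nbE) (auto simp: C_def nb_sym)
  finally show ?thesis using deg_le[of t] by simp
qed

section \<open>Bounds for the sum of the gains\<close>

lemma sum_gain_le_Y:
  assumes "\<A> \<subseteq> C ` X" "\<And>A. A \<in> \<A> \<Longrightarrow> real (card A) \<le> c"
  shows "(\<Sum>A\<in>\<A>. gain A) \<le> c * card {y\<in>Y. T - C y \<in> \<A>}"
proof -
  have "(\<Sum>A\<in>\<A>. gain A) \<le> (\<Sum>A\<in>\<A>. \<Sum>y\<in>YA A. c)"
  proof (rule sum_mono)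
    fix A assume A: "A \<in> \<A>"
    then have "A \<in> C ` X" using assms by auto
    then have "gain A \<le> (\<Sum>y\<in>YA A. real (card (nb F y)) - real (defect y))" by (rule gain_le_Y)
    also have "\<dots> \<le> (\<Sum>y\<in>YA A. c)"
      using net_degree card_C_YA[OF _ \<open>A \<in> C ` X\<close>] assms(2)[OF A] by (intro sum_mono) (smt (verit))
    finally show "gain A \<le> (\<Sum>y\<in>YA A. c)" .
  qed
  also have "\<dots> = c * card {y\<in>Y. T - C y \<in> \<A>}" using sum_over_YA[OF assms(1), of "\<lambda>_. c"] by simp
  finally show ?thesis .
qed

lemma sum_gain_le_X:
  assumes "\<A> \<subseteq> C ` X" "\<And>A. A \<in> \<A> \<Longrightarrow> real D - real (card A) \<le> c"
  shows "(\<Sum>A\<in>\<A>. gain A) \<le> c * card {x\<in>X. C x \<in> \<A>}"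
proof -
  have "(\<Sum>A\<in>\<A>. gain A) \<le> (\<Sum>A\<in>\<A>. \<Sum>x\<in>XA A. c)"
  proof (rule sum_mono)
    fix A assume A: "A \<in> \<A>"
    have "gain A \<le> (\<Sum>x\<in>XA A. real (card (nb F x)) - real (defect x))" by (rule gain_le_X)
    also have "\<dots> \<le> (\<Sum>x\<in>XA A. c)"
    proof (rule sum_mono)
      fix x assume "x \<in> XA A"
      then have "C x = A" by (simp add: XA_def)
      then show "real (card (nb F x)) - real (defect x) \<le> c" using net_degree[of x] assms(2)[OF A] by simp
    qed
    finally show "gain A \<le> (\<Sum>x\<in>XA A. c)" .
  qed
  also have "\<dots> = c * card {x\<in>X. C x \<in> \<A>}" using sum_over_XA[OF assms(1), of "\<lambda>_. c"] by simp
  finally show ?thesis .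
qed

text \<open>Classes with at most half of \<open>T\<close> are counted from the \<open>Y\<close>
  side, the others from the \<open>X\<close> side, with at most \<open>D / 2\<close> per vertex;
  \<open>slots\<close> bounds the number of vertices used.\<close>

lemma gain_sum_median: "(\<Sum>A\<in>C ` X. gain A) \<le> real \<Delta> * real D / 2"
proof -
  let ?L = "{A\<in>C ` X. 2 * card A \<le> D}" and ?R = "{A\<in>C ` X. \<not> 2 * card A \<le> D}"
  have "(\<Sum>A\<in>C ` X. gain A) = (\<Sum>A\<in>?L. gain A) + (\<Sum>A\<in>?R. gain A)"
    using finXY by (subst sum.union_disjoint[symmetric]) (auto intro: sum.cong)
  also have "\<dots> \<le> D / 2 * card {y\<in>Y. T - C y \<in> ?L} + D / 2 * card {x\<in>X. C x \<in> ?R}"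
    by (intro add_mono sum_gain_le_X sum_gain_le_Y) auto
  also have "\<dots> = D / 2 * real (card {y\<in>Y. T - C y \<in> ?L} + card {x\<in>X. C x \<in> ?R})"
    by (simp add: algebra_simps)
  also have "\<dots> \<le> D / 2 * real \<Delta>"
  proof (intro mult_left_mono of_nat_mono slots)
    fix A B assume AB: "A \<in> ?L" "B \<in> ?R"
    then have "\<not> B \<subseteq> A" using class_props[of A] card_mono[of A B] by fastforce
    then show "A \<subset> B" using AB classes_chain[of A B] by auto
  qed auto
  finally show ?thesis by (simp add: mult.commute)
qed

text \<open>\<open>capX\<close> and \<open>capY\<close> come from \<open>class_complete\<close>, and
  hypothesis \<open>D\<close> becomes \<open>d_le\<close>.\<close>

lemma class_bipartite:
  assumes A: "A \<in> C ` X" and D: "2 * (\<Delta> - D) \<le> D"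
  shows "bipartite_class (XA A) (YA A) {x\<in>XA A. nb S x \<inter> T \<noteq> {}} {y\<in>YA A. nb S y \<inter> T \<noteq> {}}
    (\<lambda>x y. y \<in> nb F x) (\<lambda>q. real (defect q)) (real (card A)) (real D - real (card A)) (real \<Delta> - real D)"
proof -
  have AD: "card A \<le> D" using class_props[OF A] finT by (simp add: D_def card_mono psubset_imp_subset)
  have CX: "card (C x) = card A" if "x \<in> XA A" for x using that by (simp add: XA_def)
  note CY = card_C_YA[OF _ A]
  note nbX = nbF_XA and nbY = nbF_YA[OF _ A]
  have XY: "XA A \<inter> T = {}" "YA A \<inter> T = {}"
    using VF_not_T by (auto simp: XA_def YA_def X_def Y_def V_def)
  show ?thesis
  proof
    show "finite (XA A)" "finite (YA A)" by (rule finXA)+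
    fix x assume x: "x \<in> XA A"
    show "real (card {y \<in> YA A. y \<in> nb F x}) \<le> real D - real (card A) + (real \<Delta> - real D)"
      using far_degree[of x] by (simp add: nbX[OF x] CX[OF x] flip: of_nat_add)
    show "real (card {y \<in> YA A. y \<in> nb F x}) - real (defect x) \<le> real D - real (card A)"
      using net_degree[of x] by (simp add: nbX[OF x] CX[OF x])
  next
    fix y assume y: "y \<in> YA A"
    show "real (card {x \<in> XA A. y \<in> nb F x}) \<le> real (card A) + (real \<Delta> - real D)"
      using far_degree[of y] CY[OF y] by (simp add: nbY[OF y])
    show "real (card {x \<in> XA A. y \<in> nb F x}) - real (defect y) \<le> real (card A)"
      using net_degree[of y] CY[OF y] by (simp add: nbY[OF y])
  next
    fix x assume "x \<in> XA A - {x \<in> XA A. nb S x \<inter> T \<noteq> {}}"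
    then show "real (defect x) = real (card A)" using card_C[of x] CX[of x] by simp
  next
    fix y assume "y \<in> YA A - {y \<in> YA A. nb S y \<inter> T \<noteq> {}}"
    then show "real (defect y) = real D - real (card A)" using card_C[of y] CY[of y] by simp
  next
    fix x assume x: "x \<in> {x \<in> XA A. nb S x \<inter> T \<noteq> {}}"
    let ?Y = "{y \<in> YA A. nb S y \<inter> T \<noteq> {}}" and ?Z = "{y \<in> YA A - {y \<in> YA A. nb S y \<inter> T \<noteq> {}}. y \<in> nb F x}"
    have "card ?Y + card ?Z = card (?Y \<union> ?Z)"
      using finXA by (intro card_Un_disjoint[symmetric]) auto
    moreover have "?Y \<union> ?Z \<subseteq> nb E x"
      using x class_complete nb_mono[OF F_sub(2)] by fast
    then have "card (?Y \<union> ?Z) + card (C x) \<le> \<Delta>"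
      using XY by (intro deg_outside_T) auto
    ultimately show "real (card ?Y) + real (card ?Z) \<le> real D - real (card A) + (real \<Delta> - real D)"
      using x CX[of x] by (simp flip: of_nat_add)
  next
    fix y assume y: "y \<in> {y \<in> YA A. nb S y \<inter> T \<noteq> {}}"
    let ?X = "{x \<in> XA A. nb S x \<inter> T \<noteq> {}}" and ?Z = "{x \<in> XA A - {x \<in> XA A. nb S x \<inter> T \<noteq> {}}. y \<in> nb F x}"
    have "card ?X + card ?Z = card (?X \<union> ?Z)"
      using finXA by (intro card_Un_disjoint[symmetric]) auto
    moreover have "?X \<union> ?Z \<subseteq> nb E y"
      using y class_complete nb_mono[OF F_sub(2)] nb_sym by fast
    then have "card (?X \<union> ?Z) + card (C y) \<le> \<Delta>"
      using XY by (intro deg_outside_T) auto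
    ultimately show "real (card ?X) + real (card ?Z) \<le> real (card A) + (real \<Delta> - real D)"
      using y CY[of y] by simp
  qed (use AD D D_le in \<open>auto simp: of_nat_diff\<close>)
qed

lemma gain_eq_excess:
  assumes A: "A \<in> C ` X" and D: "2 * (\<Delta> - D) \<le> D"
  shows "gain A = bipartite_class.excess (XA A) (YA A) (\<lambda>x y. y \<in> nb F x) (\<lambda>q. real (defect q))"
proof -
  interpret bipartite_class "XA A" "YA A" "{x\<in>XA A. nb S x \<inter> T \<noteq> {}}" "{y\<in>YA A. nb S y \<inter> T \<noteq> {}}"
    "\<lambda>x y. y \<in> nb F x" "\<lambda>q. real (defect q)" "real (card A)" "real D - real (card A)" "real \<Delta> - real D"
    by (rule class_bipartite[OF assms])
  show ?thesis unfolding excess_def edge_count_def gain_def using nbF_XA by simp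
qed

text \<open>\<open>A\<close> is a largest class satisfying the condition on smaller classes, which a
  minimal class satisfies vacuously. The next class above \<open>A\<close> violates it, and
  \<open>yield\<close> turns this violation into the condition on larger classes for
  \<open>A\<close>.\<close>

lemma payer_class:
  assumes P: "\<P> \<subseteq> C ` X" "\<P> \<noteq> {}"
  obtains A where "A \<in> \<P>" "\<And>A' x. A' \<in> \<P> \<Longrightarrow> A' \<subset> A \<Longrightarrow> x \<in> XA A \<Longrightarrow> nb S x \<inter> A' = {}"
    "\<And>A' y. A' \<in> \<P> \<Longrightarrow> A \<subset> A' \<Longrightarrow> y \<in> YA A \<Longrightarrow> nb S y \<inter> (T - A') = {}"
proof -
  define good where "good A \<longleftrightarrow> (\<forall>A'\<in>\<P>. A' \<subset> A \<longrightarrow> (\<forall>x\<in>XA A. nb S x \<inter> A' = {}))" for A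
  have fin: "finite \<P>" using finite_classes P by blast
  obtain A0 where A0: "A0 \<in> \<P>" "\<forall>B\<in>\<P>. B \<subseteq> A0 \<longrightarrow> A0 = B"
    using finite_has_minimal[OF fin P(2)] by blast
  then have "good A0" by (auto simp: good_def)
  then have "finite {A\<in>\<P>. good A}" "{A\<in>\<P>. good A} \<noteq> {}" using fin A0(1) by auto
  from finite_has_maximal[OF this] obtain A where A0: "A \<in> {A\<in>\<P>. good A}"
    "\<forall>B\<in>{A\<in>\<P>. good A}. A \<subseteq> B \<longrightarrow> A = B" ..
  then have A: "A \<in> \<P>" "good A" "\<And>B. B \<in> \<P> \<Longrightarrow> good B \<Longrightarrow> A \<subseteq> B \<Longrightarrow> A = B" by simp_all
  have "nb S y \<inter> (T - A') = {}" if A': "A' \<in> \<P>" "A \<subset> A'" and y: "y \<in> YA A" for A' y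
  proof -
    have "finite {B\<in>\<P>. A \<subset> B}" "{B\<in>\<P>. A \<subset> B} \<noteq> {}" using fin A' by auto
    from finite_has_minimal[OF this] obtain B where B0: "B \<in> {B\<in>\<P>. A \<subset> B}"
      "\<forall>B'\<in>{B\<in>\<P>. A \<subset> B}. B' \<subseteq> B \<longrightarrow> B = B'" ..
    then have B: "B \<in> \<P>" "A \<subset> B" "\<And>B'. B' \<in> \<P> \<Longrightarrow> A \<subset> B' \<Longrightarrow> B' \<subseteq> B \<Longrightarrow> B = B'"
      by simp_all
    then have "\<not> good B" using A(3)[OF B(1)] by (metis psubset_eq)
    then obtain B' x where B': "B' \<in> \<P>" "B' \<subset> B" "x \<in> XA B" "nb S x \<inter> B' \<noteq> {}" by (auto simp: good_def)
    have "B' \<subseteq> A \<or> A \<subset> B'" using classes_chain[OF subsetD[OF P(1) B'(1)] subsetD[OF P(1) A(1)]] by auto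
    then have "B' \<subseteq> A" using B(3)[OF B'(1)] B'(2) by auto
    then have "nb S x \<inter> A \<noteq> {}" using B' by blast
    then have "nb S y \<inter> (T - B) = {}" using yield[OF B'(3) y B(2)] by simp
    moreover have "B \<subseteq> A'" 
      using classes_chain[OF subsetD[OF P(1) B(1)] subsetD[OF P(1) A'(1)]] B(3)[OF A'] by auto
    ultimately show ?thesis by blast
  qed
  then show ?thesis using that A(1,2) by (auto simp: good_def)
qed

text \<open>The smaller classes gain at most \<open>card AL\<close> for each of \<open>l\<close>
  vertices, the larger ones \<open>card BR\<close> for each of \<open>r\<close>. These rates are
  also lower bounds for the defects in \<open>XA A\<close> and \<open>YA A\<close>, so
  \<open>excess_bound_two_sided\<close> covers everything at once.\<close>

lemma gain_sum_payer:
  assumes D: "2 * (\<Delta> - D) \<le> D"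
  shows "(\<Sum>A\<in>C ` X. gain A) \<le> (real \<Delta> / 2)\<^sup>2 + (real \<Delta> - real D)\<^sup>2"
proof -
  \<comment> \<open>An upper bound may ignore the other classes, and
    \<open>excess_bound_two_sided\<close> asks for a positive excess.\<close>
  define \<P> where "\<P> = {A\<in>C ` X. gain A > 0}"
  have P: "\<P> \<subseteq> C ` X" by (auto simp: \<P>_def)
  have "(\<Sum>A\<in>C ` X. gain A) = (\<Sum>A\<in>\<P>. gain A) + (\<Sum>A\<in>C ` X - \<P>. gain A)"
    using sum.subset_diff[OF P, of gain] finXY by simp
  moreover have "(\<Sum>A\<in>C ` X - \<P>. gain A) \<le> 0" by (rule sum_nonpos) (auto simp: \<P>_def)
  ultimately have le: "(\<Sum>A\<in>C ` X. gain A) \<le> (\<Sum>A\<in>\<P>. gain A)" by simp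
  show ?thesis
  proof (cases "\<P> = {}")
    case True
    then show ?thesis using le by (smt (verit) sum.empty zero_le_power2)
  next
    case False
    then obtain A where A: "A \<in> \<P>" "\<And>A' x. A' \<in> \<P> \<Longrightarrow> A' \<subset> A \<Longrightarrow> x \<in> XA A \<Longrightarrow> nb S x \<inter> A' = {}"
      "\<And>A' y. A' \<in> \<P> \<Longrightarrow> A \<subset> A' \<Longrightarrow> y \<in> YA A \<Longrightarrow> nb S y \<inter> (T - A') = {}"
      using payer_class[OF P] by metis
    have AX: "A \<in> C ` X" using A P by auto
    note Ap = class_props[OF AX]
    define L where "L = {A'\<in>\<P>. A' \<subset> A}"
    define R where "R = {A'\<in>\<P>. A \<subset> A'}"
    have LR: "L \<subseteq> C ` X" "R \<subseteq> C ` X" using P by (auto simp: L_def R_def)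
    have PLR: "\<P> = insert A (L \<union> R)" 
    proof -
      have "A' \<subset> A \<or> A' = A \<or> A \<subset> A'" if "A' \<in> \<P>" for A'
        using classes_chain[of A A'] that A(1) P by blast
      then show ?thesis using A(1) by (auto simp: L_def R_def)
    qed
    define l where "l = card {y\<in>Y. T - C y \<in> L}"
    define r where "r = card {x\<in>X. C x \<in> R}"
    \<comment> \<open>In a chain, \<open>AL\<close> is the largest class of \<open>\<P>\<close>
      below \<open>A\<close>, and \<open>BR\<close> the complement of the smallest one above
      \<open>A\<close>, or else they are empty.\<close>
    define AL where "AL = \<Union>L"
    define BR where "BR = (\<Union>A'\<in>R. T - A')"
    have AL: "AL \<subseteq> A" "finite AL" using Ap finite_subset[of AL A] by (auto simp: AL_def L_def)
    have BR: "BR \<subseteq> T - A" "finite BR" using finT finite_subset[of BR "T - A"] by (auto simp: BR_def R_def)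
    have "(\<Sum>A\<in>\<P>. gain A) = gain A + ((\<Sum>A\<in>L. gain A) + (\<Sum>A\<in>R. gain A))"
      unfolding PLR using finite_classes[OF LR(1)] finite_classes[OF LR(2)]
      by (subst sum.insert, auto simp: L_def R_def intro!: sum.union_disjoint)
    also have "(\<Sum>A\<in>L. gain A) \<le> real (card AL) * real l"
      unfolding l_def using LR AL by (intro sum_gain_le_Y) (auto simp: AL_def intro: card_mono)
    also have "(\<Sum>A\<in>R. gain A) \<le> real (card BR) * real r"
    proof -
      have "real D - real (card A') \<le> card BR" if "A' \<in> R" for A'
      proof -
        have "A' \<subset> T \<and> finite A'" using class_props[of A'] that LR(2) by auto
        then have "real D - real (card A') = card (T - A')"
          using finT by (simp add: D_def card_Diff_subset of_nat_diff card_mono psubset_imp_subset)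
        also have "\<dots> \<le> card BR" using that BR by (auto simp: BR_def intro: card_mono)
        finally show ?thesis .
      qed
      then show ?thesis unfolding r_def using sum_gain_le_X[OF LR(2)] by simp
    qed
    finally have sum_le: "(\<Sum>A\<in>\<P>. gain A) \<le> gain A + card AL * real l + card BR * real r" by simp
    interpret bipartite_class "XA A" "YA A" "{x\<in>XA A. nb S x \<inter> T \<noteq> {}}" "{y\<in>YA A. nb S y \<inter> T \<noteq> {}}"
      "\<lambda>x y. y \<in> nb F x" "\<lambda>q. real (defect q)" "real (card A)" "real D - real (card A)" "real \<Delta> - real D"
      by (rule class_bipartite[OF AX D])
    have cardX: "card (XA A) + r = card {x\<in>X. C x \<in> insert A R}"
    proof -
      have "{x\<in>X. C x \<in> insert A R} = XA A \<union> {x\<in>X. C x \<in> R}" by (auto simp: XA_def)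
      then show ?thesis unfolding r_def using finXA finXY
        by (simp, intro card_Un_disjoint[symmetric]) (auto simp: XA_def R_def)
    qed
    have cardY: "card (YA A) + l = card {y\<in>Y. T - C y \<in> insert A L}"
    proof -
      have "T - C y = A \<longleftrightarrow> C y = T - A" for y using Ap C_sub[of y] by blast
      then have YA: "YA A = {y\<in>Y. T - C y = A}" by (auto simp: YA_def)
      then have "{y\<in>Y. T - C y \<in> insert A L} = YA A \<union> {y\<in>Y. T - C y \<in> L}" by auto
      then show ?thesis unfolding l_def using finXA finXY YA
        by (simp, intro card_Un_disjoint[symmetric]) (auto simp: L_def)
    qed
    have "excess + card AL * real l + card BR * real r
        \<le> ((real (card A) + (real D - real (card A)) + (real \<Delta> - real D)) / 2)\<^sup>2 + (real \<Delta> - real D)\<^sup>2"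
    proof (rule excess_bound_two_sided)
      show "real (card AL) \<le> real (card A)" using AL Ap by (simp add: card_mono)
      show "real (card BR) \<le> real D - real (card A)"
      proof -
        have "card BR \<le> card (T - A)" using BR finT by (intro card_mono) auto
        also have "real (card (T - A)) = real D - real (card A)"
          using finT Ap by (simp add: D_def card_Diff_subset of_nat_diff card_mono psubset_imp_subset)
        finally show ?thesis by simp
      qed
      show "real (card AL) \<le> real (defect x)" if x: "x \<in> XA A" for x
      proof -
        have "nb S x \<inter> AL = {}" using A(2) x by (auto simp: AL_def L_def)
        moreover have "AL \<subseteq> nb E x \<inter> T" using x AL(1) by (auto simp: XA_def C_def)
        ultimately show ?thesis unfolding defect_def using finT by (intro of_nat_mono card_mono) auto
      qed
      show "real (card BR) \<le> real (defect y)" if y: "y \<in> YA A" for y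
      proof -
        have "nb S y \<inter> BR = {}" using A(3) y by (fastforce simp: BR_def R_def)
        moreover have "BR \<subseteq> nb E y \<inter> T" using y BR(1) by (auto simp: YA_def C_def)
        ultimately show ?thesis unfolding defect_def using finT by (intro of_nat_mono card_mono) auto
      qed
      \<comment> \<open>The class \<open>A\<close> may be counted on either side of the cut: here
        with the larger classes, below with the smaller ones.\<close>
      have "l + (card (XA A) + r) \<le> \<Delta>"
        unfolding cardX l_def by (rule slots) (use AX LR in \<open>auto simp: L_def R_def\<close>)
      then show "real (card (XA A)) + (real l + real r) \<le> real (card A) + (real D - real (card A)) + (real \<Delta> - real D)"
        by simp
      have "(card (YA A) + l) + r \<le> \<Delta>"
        unfolding cardY r_def by (rule slots) (use AX LR in \<open>auto simp: L_def R_def\<close>)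
      then show "real (card (YA A)) + (real l + real r) \<le> real (card A) + (real D - real (card A)) + (real \<Delta> - real D)"
        by simp
      show "0 < excess" using A(1) gain_eq_excess[OF AX D] by (simp add: \<P>_def)
    qed auto
    then show ?thesis using le sum_le gain_eq_excess[OF AX D] by simp
  qed
qed

end

section \<open>The bound for triangle-free graphs\<close>

context triangle_free_linked
begin

lemma card_S_le_triangle_free: "real (card S) \<le> 5 / 4 * (real \<Delta>)\<^sup>2"
proof (cases "card S \<le> \<Delta>\<^sup>2")
  case True
  then have "real (card S) \<le> (real \<Delta>)\<^sup>2" by (metis of_nat_le_iff of_nat_power)
  moreover have "0 \<le> (real \<Delta>)\<^sup>2" by simp
  ultimately show ?thesis by linarith
next
  case False
  \<comment> \<open>Otherwise every far edge has an end with trace \<open>T\<close>, and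
    \<open>card_S_le_no_split\<close> already bounds \<open>card S\<close>.\<close>
  have "V \<noteq> {}"
  proof
    assume "V = {}"
    have "card S \<le> \<Delta>\<^sup>2"
    proof (rule card_S_le_no_split[of w D])
      show "card (nb S w) = D" "\<And>z. card (nb S z) \<le> D" using max_deg by (auto simp: D_def T_def)
      fix e assume "e \<in> S" "e \<inter> nb E w = {}"
      then have e: "e \<in> F" by (simp add: F_def)
      then obtain x y where xy: "e = {x, y}" using F_sub edge_cases by (metis subsetD)
      then have yx: "y \<in> nb F x" using e by (simp add: nb_def insert_commute)
      then have "C x = {} \<or> C x = T" using nbF_VF[OF yx] \<open>V = {}\<close> by (auto simp: V_def)
      then have "C x = T \<or> C y = T" using C_compl[OF yx] by auto
      then show "\<exists>x\<in>e. nb S w \<subseteq> nb E x" using xy by (auto simp: C_def T_def)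
    qed
    then show False using False by simp
  qed
  then obtain x0 where x0: "x0 \<in> V" "\<And>q. q \<in> V \<Longrightarrow> card (C x0) \<le> card (C q)"
    using ex_has_least_nat[of "\<lambda>q. q \<in> V" _ "\<lambda>q. card (C q)"] by (metis all_not_in_conv)
  then obtain t0 where t0: "t0 \<in> C x0" by (auto simp: V_def)
  interpret far_chain E S \<Delta> w x0 t0 using x0 t0 by unfold_locales
  have "real (card S + (\<Sum>q\<in>\<Union>F. defect q)) \<le> real (D * \<Delta> + D * (\<Delta> - D) + card F)"
    using card_S_le_far by (rule of_nat_mono)
  moreover have "real (D * (\<Delta> - D)) = real D * (real \<Delta> - real D)" using D_le by (simp add: of_nat_diff)
  ultimately have "real (card S) + (\<Sum>q\<in>\<Union>F. real (defect q)) \<le> real D * (2 * real \<Delta> - real D) + real (card F)"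
    unfolding of_nat_add by (simp add: algebra_simps)
  then have "real (card S) \<le> real D * (2 * real \<Delta> - real D) + (\<Sum>A\<in>C ` X. gain A)"
    using card_F_le_gain by linarith
  moreover have "real D * (2 * real \<Delta> - real D) + (\<Sum>A\<in>C ` X. gain A) \<le> 5 / 4 * (real \<Delta>)\<^sup>2"
  proof (cases "2 * (\<Delta> - D) \<le> D")
    case True
    \<comment> \<open>The terms in \<open>D\<close> cancel: \<open>D (2 \<Delta> - D) + (\<Delta> -
      D)\<^sup>2 = \<Delta>\<^sup>2\<close>.\<close>
    then show ?thesis using gain_sum_payer by (simp add: power2_eq_square algebra_simps)
  next
    case False
    then have "3 * real D \<le> 2 * real \<Delta>" using D_le by linarith
    then have "0 \<le> real \<Delta> * (2 * real \<Delta> - 3 * real D)" by simp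
    \<comment> \<open>The slack is written as a sum of terms that are nonnegative for
      \<open>3 * D \<le> 2 * \<Delta>\<close>.\<close>
    moreover have "5 / 4 * (real \<Delta>)\<^sup>2 - real D * (2 * real \<Delta> - real D) - real \<Delta> * real D / 2
        = (real \<Delta>)\<^sup>2 / 36 + 7 / 18 * (real \<Delta> * (2 * real \<Delta> - 3 * real D)) + (2 * real \<Delta> - 3 * real D)\<^sup>2 / 9"
      by (simp add: power2_eq_square field_simps)
    moreover have "0 \<le> (real \<Delta>)\<^sup>2 / 36" "0 \<le> (2 * real \<Delta> - 3 * real D)\<^sup>2 / 9" by simp_all
    ultimately show ?thesis using gain_sum_median by linarith
  qed
  ultimately show ?thesis by linarith
qed

end

section \<open>Strong cliques\<close>

lemma degree_eq_card_nb:
  assumes "simple_graph G"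
  shows "degree G v = card (nb (edges G) v)"
proof -
  have "{e \<in> edges G. v \<in> e} = (\<lambda>u. {u, v}) ` nb (edges G) v"
  proof (intro equalityI subsetI)
    fix e assume e: "e \<in> {e \<in> edges G. v \<in> e}"
    then have "card e = 2" using assms by (auto simp: simple_graph_def)
    then obtain a b where "e = {a, b}" by (auto simp: card_2_iff)
    then obtain u where "e = {u, v}" using e by auto
    then show "e \<in> (\<lambda>u. {u, v}) ` nb (edges G) v" using e by (auto simp: nb_def)
  qed (auto simp: nb_def)
  moreover have "inj_on (\<lambda>u. {u, v}) (nb (edges G) v)" by (auto simp: inj_on_def doubleton_eq_iff)
  ultimately show ?thesis by (simp add: degree_def card_image)
qed

lemma finite_edges: "simple_graph G \<Longrightarrow> finite (edges G)"
  unfolding simple_graph_def by (meson PowI finite_Pow_iff finite_subset subsetI)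

lemma nb_outside: "simple_graph G \<Longrightarrow> v \<notin> verts G \<Longrightarrow> nb (edges G) v = {}"
  by (auto simp: nb_def simple_graph_def)

lemma strong_clique_linked_edges:
  assumes G: "simple_graph G" and S: "strong_clique G S"
  shows "linked_edges (edges G) S (max_degree G)"
proof
  show "finite (edges G)" using finite_edges[OF G] .
  show "card e = 2" if "e \<in> edges G" for e using G that by (simp add: simple_graph_def)
  show "S \<subseteq> edges G" using S by (simp add: strong_clique_def)
  show "card (nb (edges G) v) \<le> max_degree G" for v
  proof (cases "v \<in> verts G")
    case True
    then have "degree G v \<le> max_degree G"
      using G unfolding max_degree_def simple_graph_def by (intro Max_ge) auto
    then show ?thesis by (simp add: degree_eq_card_nb[OF G])
  next
    case False
    then show ?thesis using nb_outside[OF G] by simp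
  qed
  fix e f assume *: "e \<in> S" "f \<in> S" "e \<inter> f = {}"
  have "card e = 2" using *(1) G S by (auto simp: simple_graph_def strong_clique_def)
  then have "e \<noteq> f" using *(3) by auto
  then show "\<exists>u\<in>e. \<exists>v\<in>f. {u, v} \<in> edges G" using * S by (simp add: strong_clique_def)
qed

lemma strong_clique_number_attained:
  assumes "simple_graph G"
  obtains S where "strong_clique G S" "strong_clique_number G = card S"
proof -
  have "{card S | S. strong_clique G S} \<subseteq> card ` Pow (edges G)" by (auto simp: strong_clique_def)
  then have "finite {card S | S. strong_clique G S}" using finite_edges[OF assms] finite_subset by fastforce
  moreover have "strong_clique G {}" by (simp add: strong_clique_def)
  ultimately have "Max {card S | S. strong_clique G S} \<in> {card S | S. strong_clique G S}"
    by (intro Max_in) auto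
  then show ?thesis using that by (auto simp: strong_clique_number_def)
qed

lemma cycle_free_list:
  assumes "simple_graph G" "free_of (cycle_graph m) G" "2 \<le> m"
    and "distinct xs" "length xs = m" "successively (\<lambda>u v. {u, v} \<in> edges G) xs"
  shows "{last xs, hd xs} \<notin> edges G"
  using assms contains_cycle_graph[of G xs] by (auto simp: free_of_def)

theorem theorem6:
  fixes G :: "'a graph" and \<Delta> :: nat
  assumes "simple_graph G"
    and "max_degree G = \<Delta>"
  shows "(triangle_free G \<longrightarrow> real (strong_clique_number G) \<le> 5 / 4 * (real \<Delta>)\<^sup>2) \<and>
    (free_of (cycle_graph 5) G \<longrightarrow> strong_clique_number G \<le> \<Delta>\<^sup>2) \<and>
    (\<forall>k::nat. k \<ge> 3 \<longrightarrow> free_of (cycle_graph (2 * k + 1)) G \<longrightarrow> \<Delta> \<ge> 3 * k\<^sup>2 + 10 * k \<longrightarrow>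
      strong_clique_number G \<le> \<Delta>\<^sup>2)"
proof -
  obtain S where S: "strong_clique G S" "strong_clique_number G = card S"
    using strong_clique_number_attained[OF assms(1)] .
  interpret linked_edges "edges G" S \<Delta>
    using strong_clique_linked_edges[OF assms(1) S(1)] assms(2) by simp
  note cycle_free = cycle_free_list[OF assms(1)]
  have "\<forall>z. card (nb S z) < Suc \<Delta>"
    using le_trans[OF card_mono[OF finite_nbE nb_S_sub] deg_le] by (simp add: less_Suc_eq_le)
  then obtain w where w: "\<And>z. card (nb S z) \<le> card (nb S w)"
    using ex_has_greatest_nat[of "\<lambda>_. True" undefined "\<lambda>z. card (nb S z)" "Suc \<Delta>"] by auto
  have "real (card S) \<le> 5 / 4 * (real \<Delta>)\<^sup>2" if free: "triangle_free G"
  proof -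
    interpret triangle_free_linked "edges G" S \<Delta> w
    proof
      fix x y z assume *: "x \<in> nb (edges G) y" "z \<in> nb (edges G) y"
      show "x \<notin> nb (edges G) z"
      proof
        assume xz: "x \<in> nb (edges G) z"
        have "distinct [x, y, z]" using * xz nb_irrefl by auto
        then have "{last [x, y, z], hd [x, y, z]} \<notin> edges G"
          using free * by (intro cycle_free[of 3]) (auto simp: triangle_free_def nb_def insert_commute)
        then show False using xz by (simp add: nb_def insert_commute)
      qed
    qed (rule w)
    show ?thesis by (rule card_S_le_triangle_free)
  qed
  moreover have "card S \<le> \<Delta>\<^sup>2" if free: "free_of (cycle_graph 5) G"
  proof (rule ccontr)
    assume "\<not> card S \<le> \<Delta>\<^sup>2"
    from split_pair[OF refl w this] obtain x y p q where
      *: "{x, y} \<in> S" "p \<in> nb S w" "q \<in> nb S w" "p \<in> nb (edges G) x" "q \<in> nb (edges G) y"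
        "distinct [w, p, x, y, q]" by metis
    have "p \<in> nb (edges G) w" "q \<in> nb (edges G) w" "{x, y} \<in> edges G"
      using *(1-3) nb_S_sub[of w] S_sub by auto
    then have "successively (\<lambda>u v. {u, v} \<in> edges G) [w, p, x, y, q]" "{q, w} \<in> edges G"
      using * by (auto simp: nb_def insert_commute)
    then show False using cycle_free[OF free _ *(6)] by simp
  qed
  moreover have "card S \<le> \<Delta>\<^sup>2"
    if k: "k \<ge> 3" and free: "free_of (cycle_graph (2 * k + 1)) G" and \<Delta>: "\<Delta> \<ge> 3 * k\<^sup>2 + 10 * k" for k
  proof (rule card_S_le_odd_cycle_free[OF _ k _ refl w])
    show "{last xs, hd xs} \<notin> edges G"
      if "distinct xs" "length xs = 2 * k + 1" "successively adj xs" for xs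
      using cycle_free[OF free _ that] k by simp
    \<comment> \<open>The summand \<open>3 * k\<^sup>2\<close> is then at least 27 and covers the
      constant 12.\<close>
    have "3\<^sup>2 \<le> k\<^sup>2" using k by (intro power_mono) auto
    then show "10 * k + 12 \<le> \<Delta>" using \<Delta> by simp
  qed
  ultimately show ?thesis using S(2) by auto
qed

end
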